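(* Let $S$ be a finite semigroup such that $\mathbb{C}S$ is a unital algebra, and suppose that $S$ is $\ll$-smooth. For $s\in S$ put $$y_s=\sum_{t\ll s}\mu_S(t,s)\,x_t .$$ Then $$\theta_S(X)=\pm\prod_{e\in E(S)}\widetilde{\theta}_e(Y_e),$$ where $Y_e=\{y_s\mid s\in\widetilde{L}_e\widetilde{R}_e\}$. Moreover, the determinant $\theta_S(X)$ of $S$ is nonzero if and only if $\widetilde{\theta}_e(Y_e)\neq 0$ for every idempotent $e\in E(S)$.
   Context: Let $S$ be a finite semigroup with $\mathbb{C}S$ unital, and let $E(S)$ be its set of idempotents. $X=\{x_s\mid s\in S\}$ is a set of commuting variables and $\theta_S(X)=\det (x_{st})_{s,t\in S}$ is the semigroup determinant. For $s\in S$ put $\varphi^{\ast}(s)=\{e\in E(S)\mid se=s\}$ and $\varphi^{+}(s)=\{e\in E(S)\mid es=s\}$ (both nonempty since $\mathbb{C}S$ is unital). The kernel of a finite semigroup is its minimal ideal. Let $s^{\ast\ast}$ and $s^{++}$ be the kernels of the subsemigroups $\langle\varphi^{\ast}(s)\rangle$ and $\langle\varphi^{+}(s)\rangle$. $S$ is singleton-rich if $|s^{\ast\ast}|=|s^{++}|=1$ for all $s\in S$; then $s^{\ast}$, $s^{+}$ denote the unique elements of $s^{\ast\ast}$, $s^{++}$ (they are idempotents). In a singleton-rich semigroup, $s\ll t$ means $s=s^{+}ts^{\ast}$; this relation is reflexive and antisymmetric. $S$ is called $\ll$-transitive if $\ll$ is transitive; then $\ll$ is a partial order and $\mu_S$ denotes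 its Möbius function. For $e\in E(S)$, $\widetilde{L}_e=\{s\in S\mid s^{\ast}=e\}$ and $\widetilde{R}_e=\{s\in S\mid s^{+}=e\}$, and $\widetilde{L}_e\widetilde{R}_e=\{st\mid s\in\widetilde{L}_e,t\in\widetilde{R}_e\}$. Functions and sequences: $\varphi(s,t)=(s^{\ast}t)^{+}$. For $s,t\in S$ set $s^{\varphi}_0=s$, $t^{\varphi}_0=t$, $s^{\varphi}_{i+1}=s^{\varphi}_i\,\varphi(s^{\varphi}_i,t^{\varphi}_i)$, $t^{\varphi}_{i+1}=(s^{\varphi}_i)^{\ast}t^{\varphi}_i$. The sequence $\varphi(s^{\varphi}_i,t^{\varphi}_i)$ is eventually constant; its eventual value is denoted $\varphi^{(s,t)}$. Products: for $s,t\in S$, $s\,\sharp\,t=st$ if $s^{+}=(st)^{+}$, $t^{\ast}=(st)^{\ast}$ and $s^{\ast}=t^{+}$, and $s\,\sharp\,t=0$ (the zero of the vector space $\mathbb{C}S$) otherwise. For $e\in E(S)$, $s\,\sharp^{e}\,t=st$ if $s^{+}=(st)^{+}$, $t^{\ast}=(st)^{\ast}$ and $s^{\ast}=t^{+}=e$, and $0\in\mathbb{C}S$ otherwise. $\ll$-smooth: a $\ll$-transitive singleton-rich semigroup $S$ is $\ll$-smooth if for all $s''\ll s'\ll s$ and $t''\ll t'\ll t$ in $S$: (1) if $s''\,\sharp\,t''\neq0$ then $\varphi^{({s''}^{+}s',\,t'{t''}^{\ast})}=\varphi({s''}^{+}s',t'{t''}^{\ast})$; (2) if $s''\,\sharp\,t''\neq0$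 then $({s''}^{+}s')^{\ast}t'{t''}^{\ast}=t''$ if and only if $({s''}^{+}s')^{\ast}t{t''}^{\ast}=t''$; (3) if $s''({s''}^{+}s)^{\ast}=s''$ then $s''({s''}^{+}s')^{\ast}=s''$. The product $\boldsymbol{*}$: let $Z\colon\mathbb{C}S\to\mathbb{C}S$ be the linear bijection with $Z(s)=\sum_{s'\ll s}s'$ for $s\in S$. The bilinear product $\boldsymbol{*}$ on $\mathbb{C}S$ is determined by $$Z(s)\boldsymbol{*}Z(t)=\sum_{s'\ll s,\ t'\ll t}s'\,\sharp^{\varphi^{({s'}^{+}s,\,t{t'}^{\ast})}}\,t'\qquad(s,t\in S).$$ The Cayley table of $(S,\boldsymbol{*})$ is the $S\times S$ matrix whose $(s,t)$ entry is $\sum_{u\in S}c_u x_u$, where $s\boldsymbol{*}t=\sum_u c_u u$. For $e\in E(S)$, with $X_e=\{x_s\mid s\in\widetilde{L}_e\widetilde{R}_e\}$, $\widetilde{\theta}_e(X_e)$ denotes the determinant of the $\widetilde{L}_e\times\widetilde{R}_e$ submatrix (rows indexed by $\widetilde{L}_e$, columns by $\widetilde{R}_e$, in some chosen orders) of the Cayley table of $(S,\boldsymbol{*})$, understood to be $0$ if $|\widetilde{L}_e|\neq|\widetilde{R}_e|$; $\widetilde{\theta}_e(Y_e)$ is obtained from it by substituting $y_s$ for each $x_s$. *)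

theory Defs
  imports "HOL-Library.Poly_Mapping" "Jordan_Normal_Form.Determinant"
begin

text \<open>
  The semigroup \<open>S\<close> is a type of class \<open>finite\<close> and \<open>semigroup_mult\<close>; properties of \<open>S\<close> as a
  whole take a type argument. The space \<open>\<complex>S\<close> is the type of finitely supported functions
  \<open>'a \<Rightarrow>\<^sub>0 complex\<close>, in which \<open>s \<in> S\<close> is \<open>Poly_Mapping.single s 1\<close>. Since the type \<open>'a\<close> carries no
  addition, \<open>Poly_Mapping\<close> puts no multiplication on it.
\<close>

type_synonym 'a salg = "'a \<Rightarrow>\<^sub>0 complex"

definition basis :: "'a \<Rightarrow> 'a salg" where
  "basis s = Poly_Mapping.single s 1"

definition scale :: "complex \<Rightarrow> 'a salg \<Rightarrow> 'a salg" where
  "scale c f = Poly_Mapping.map ((*) c) f"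

definition lin_ext :: "('a::finite \<Rightarrow> 'a salg) \<Rightarrow> 'a salg \<Rightarrow> 'a salg" where
  "lin_ext h f = (\<Sum>s\<in>UNIV. scale (Poly_Mapping.lookup f s) (h s))"

definition bilin_ext :: "('a::finite \<Rightarrow> 'a \<Rightarrow> 'a salg) \<Rightarrow> 'a salg \<Rightarrow> 'a salg \<Rightarrow> 'a salg" where
  "bilin_ext h f g = (\<Sum>s\<in>UNIV. \<Sum>t\<in>UNIV.
     scale (Poly_Mapping.lookup f s * Poly_Mapping.lookup g t) (h s t))"

definition salg_mult :: "'a::{finite,semigroup_mult} salg \<Rightarrow> 'a salg \<Rightarrow> 'a salg" where
  "salg_mult = bilin_ext (\<lambda>s t. basis (s * t))"

definition salg_unital :: "'a::{finite,semigroup_mult} itself \<Rightarrow> bool" where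
  "salg_unital _ \<longleftrightarrow> (\<exists>u::'a salg. \<forall>f. salg_mult u f = f \<and> salg_mult f u = f)"


subsection \<open>Singleton-rich semigroups\<close>

definition idempotents :: "'a::semigroup_mult set" where
  "idempotents = {e. e * e = e}"

inductive_set subsemigroup_gen :: "'a::semigroup_mult set \<Rightarrow> 'a set" for A where
  base: "a \<in> A \<Longrightarrow> a \<in> subsemigroup_gen A"
| mult: "a \<in> subsemigroup_gen A \<Longrightarrow> b \<in> subsemigroup_gen A \<Longrightarrow> a * b \<in> subsemigroup_gen A"

definition semigroup_ideal :: "'a::semigroup_mult set \<Rightarrow> 'a set \<Rightarrow> bool" where
  "semigroup_ideal T I \<longleftrightarrow> I \<noteq> {} \<and> I \<subseteq> T \<and> (\<forall>a\<in>T. \<forall>x\<in>I. a * x \<in> I \<and> x * a \<in> I)"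

definition kernel :: "'a::semigroup_mult set \<Rightarrow> 'a set" where
  "kernel T = (THE K. semigroup_ideal T K \<and> (\<forall>J. semigroup_ideal T J \<and> J \<subseteq> K \<longrightarrow> J = K))"

definition phi_star :: "'a::semigroup_mult \<Rightarrow> 'a set" where
  "phi_star s = {e \<in> idempotents. s * e = s}"

definition phi_plus :: "'a::semigroup_mult \<Rightarrow> 'a set" where
  "phi_plus s = {e \<in> idempotents. e * s = s}"

definition star_kernel :: "'a::semigroup_mult \<Rightarrow> 'a set" where
  "star_kernel s = kernel (subsemigroup_gen (phi_star s))"

definition plus_kernel :: "'a::semigroup_mult \<Rightarrow> 'a set" where
  "plus_kernel s = kernel (subsemigroup_gen (phi_plus s))"

definition singleton_rich :: "'a::semigroup_mult itself \<Rightarrow> bool" where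
  "singleton_rich _ \<longleftrightarrow> (\<forall>s::'a. card (star_kernel s) = 1 \<and> card (plus_kernel s) = 1)"

text \<open>\<open>sstar s\<close> is \<open>s\<close> with superscript \<open>*\<close>, and \<open>splus s\<close> is \<open>s\<close> with superscript \<open>+\<close>.\<close>

definition sstar :: "'a::semigroup_mult \<Rightarrow> 'a" where
  "sstar s = the_elem (star_kernel s)"

definition splus :: "'a::semigroup_mult \<Rightarrow> 'a" where
  "splus s = the_elem (plus_kernel s)"

definition Lt :: "'a::semigroup_mult \<Rightarrow> 'a set" where
  "Lt e = {s. sstar s = e}"

definition Rt :: "'a::semigroup_mult \<Rightarrow> 'a set" where
  "Rt e = {s. splus s = e}"


subsection \<open>The relation \<open>\<lless>\<close> and its Moebius function\<close>

definition ll :: "'a::semigroup_mult \<Rightarrow> 'a \<Rightarrow> bool" (infix \<open>\<lless>\<close> 50) where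
  "s \<lless> t \<longleftrightarrow> s = splus s * t * sstar s"

definition ll_transitive :: "'a::semigroup_mult itself \<Rightarrow> bool" where
  "ll_transitive _ \<longleftrightarrow> (\<forall>r s t::'a. r \<lless> s \<longrightarrow> s \<lless> t \<longrightarrow> r \<lless> t)"

text \<open>The Moebius function is the inverse of the zeta function in the incidence algebra; it is
  unique when \<open>\<lless>\<close> is a partial order.\<close>

definition mu :: "'a::{finite,semigroup_mult} \<Rightarrow> 'a \<Rightarrow> int" where
  "mu = (THE m. \<forall>s t. (\<not> s \<lless> t \<longrightarrow> m s t = 0) \<and>
     (s \<lless> t \<longrightarrow> (\<Sum>u | s \<lless> u \<and> u \<lless> t. m s u) = (if s = t then 1 else 0)))"


subsection \<open>Smooth semigroups\<close>

definition phi :: "'a::semigroup_mult \<Rightarrow> 'a \<Rightarrow> 'a" where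
  "phi s t = splus (sstar s * t)"

primrec phi_seq :: "'a::semigroup_mult \<Rightarrow> 'a \<Rightarrow> nat \<Rightarrow> 'a \<times> 'a" where
  "phi_seq s t 0 = (s, t)"
| "phi_seq s t (Suc i) = (let (a, b) = phi_seq s t i in (a * phi a b, sstar a * b))"

definition phi_lim :: "'a::semigroup_mult \<Rightarrow> 'a \<Rightarrow> 'a" where
  "phi_lim s t =
     (THE e. eventually (\<lambda>i. phi (fst (phi_seq s t i)) (snd (phi_seq s t i)) = e) sequentially)"

definition sharp :: "'a::semigroup_mult \<Rightarrow> 'a \<Rightarrow> 'a salg" where
  "sharp s t = (if splus s = splus (s * t) \<and> sstar t = sstar (s * t) \<and> sstar s = splus t
     then basis (s * t) else 0)"

definition sharp_at :: "'a::semigroup_mult \<Rightarrow> 'a \<Rightarrow> 'a \<Rightarrow> 'a salg" where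
  "sharp_at e s t =
     (if splus s = splus (s * t) \<and> sstar t = sstar (s * t) \<and> sstar s = splus t \<and> splus t = e
      then basis (s * t) else 0)"

text \<open>In the conditions below, \<open>s\<close>, \<open>s1\<close>, \<open>s2\<close> stand for \<open>s\<close>, \<open>s'\<close>, \<open>s''\<close>.\<close>

definition ll_smooth :: "'a::semigroup_mult itself \<Rightarrow> bool" where
  "ll_smooth T \<longleftrightarrow> singleton_rich T \<and> ll_transitive T \<and>
     (\<forall>s s1 s2 t t1 t2::'a. s2 \<lless> s1 \<longrightarrow> s1 \<lless> s \<longrightarrow> t2 \<lless> t1 \<longrightarrow> t1 \<lless> t \<longrightarrow>
        (sharp s2 t2 \<noteq> 0 \<longrightarrow>
           phi_lim (splus s2 * s1) (t1 * sstar t2) = phi (splus s2 * s1) (t1 * sstar t2)) \<and>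
        (sharp s2 t2 \<noteq> 0 \<longrightarrow>
           (sstar (splus s2 * s1) * t1 * sstar t2 = t2 \<longleftrightarrow>
            sstar (splus s2 * s1) * t * sstar t2 = t2)) \<and>
        (s2 * sstar (splus s2 * s) = s2 \<longrightarrow> s2 * sstar (splus s2 * s1) = s2))"


subsection \<open>The product determined by \<open>Z\<close>\<close>

definition Z :: "'a::{finite,semigroup_mult} salg \<Rightarrow> 'a salg" where
  "Z = lin_ext (\<lambda>s. \<Sum>s' | s' \<lless> s. basis s')"

definition star_Z :: "'a::{finite,semigroup_mult} \<Rightarrow> 'a \<Rightarrow> 'a salg" where
  "star_Z s t = (\<Sum>s' | s' \<lless> s. \<Sum>t' | t' \<lless> t.
     sharp_at (phi_lim (splus s' * s) (t * sstar t')) s' t')"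

text \<open>\<open>Z\<close> is a linear bijection when \<open>\<lless>\<close> is a partial order, so this is the bilinear product whose
  value at \<open>Z (basis s)\<close> and \<open>Z (basis t)\<close> is \<open>star_Z s t\<close>.\<close>

definition star_mult :: "'a::{finite,semigroup_mult} salg \<Rightarrow> 'a salg \<Rightarrow> 'a salg" where
  "star_mult f g = bilin_ext star_Z (inv_into UNIV Z f) (inv_into UNIV Z g)"


subsection \<open>Determinants\<close>

text \<open>\<open>'a spoly\<close> is the polynomial ring over \<open>\<complex>\<close> in commuting variables indexed by \<open>'a\<close>: a monomial
  is a finitely supported exponent function, and the multiplication is the one of \<open>Poly_Mapping\<close>.\<close>

type_synonym 'a spoly = "('a \<Rightarrow>\<^sub>0 nat) \<Rightarrow>\<^sub>0 complex"

definition const :: "complex \<Rightarrow> 'a spoly" where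
  "const c = Poly_Mapping.single 0 c"

definition var :: "'a \<Rightarrow> 'a spoly" where
  "var s = Poly_Mapping.single (Poly_Mapping.single s 1) 1"

definition subst_vars :: "('a \<Rightarrow> 'a spoly) \<Rightarrow> 'a spoly \<Rightarrow> 'a spoly" where
  "subst_vars y p = (\<Sum>m\<in>Poly_Mapping.keys p. const (Poly_Mapping.lookup p m) *
     (\<Prod>s\<in>Poly_Mapping.keys m. y s ^ Poly_Mapping.lookup m s))"

text \<open>The lists fix an order of the rows and of the columns.\<close>

definition submatrix_det :: "('a \<Rightarrow> 'a \<Rightarrow> 'a spoly) \<Rightarrow> 'a list \<Rightarrow> 'a list \<Rightarrow> 'a spoly" where
  "submatrix_det M rs cs = (if length rs = length cs
     then det (mat (length rs) (length cs) (\<lambda>(i, j). M (rs ! i) (cs ! j))) else 0)"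

definition enumerates :: "'a list \<Rightarrow> 'a set \<Rightarrow> bool" where
  "enumerates xs A \<longleftrightarrow> distinct xs \<and> set xs = A"

definition theta :: "'a::semigroup_mult list \<Rightarrow> 'a spoly" where
  "theta xs = submatrix_det (\<lambda>s t. var (s * t)) xs xs"

definition star_table :: "'a::{finite,semigroup_mult} \<Rightarrow> 'a \<Rightarrow> 'a spoly" where
  "star_table s t =
     (\<Sum>u\<in>UNIV. const (Poly_Mapping.lookup (star_mult (basis s) (basis t)) u) * var u)"

definition theta_tilde :: "'a::{finite,semigroup_mult} list \<Rightarrow> 'a list \<Rightarrow> 'a spoly" where
  "theta_tilde rs cs = submatrix_det star_table rs cs"

definition y_var :: "'a::{finite,semigroup_mult} \<Rightarrow> 'a spoly" where
  "y_var s = (\<Sum>t | t \<lless> s. of_int (mu t s) * var t)"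

end

theory Submission
  imports Defs
begin

text \<open>
  Write \<open>N(s, t)\<close> for the form obtained from \<open>s \<sharp> t\<close> by sending \<open>u\<close> to \<open>y\<^sub>u\<close>; it vanishes unless
  \<open>s\<^sup>* = t\<^sup>+\<close>, so up to the order of rows and columns \<open>N\<close> is block diagonal with blocks indexed by
  the idempotents. Iterating \<open>\<phi>\<close> factors every \<open>u \<lless> st\<close> uniquely as \<open>u = s't'\<close> with \<open>s' \<lless> s\<close>,
  \<open>t' \<lless> t\<close>, \<open>s' \<sharp> t' \<noteq> 0\<close> and the prescribed limit of \<open>\<phi>\<close>, which says that \<open>Z\<close> is multiplicative.
  Smoothness makes the limit condition depend on \<open>s'\<close> and \<open>s\<close> only. Therefore the Cayley table
  \<open>(x\<^bsub>st\<^esub>)\<close> is \<open>A N B\<close>, and the table of the product \<open>*\<close>, written in the \<open>y\<close>, is \<open>C N\<close>, where \<open>A\<close>,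
  \<open>B\<close>, \<open>C\<close> are unitriangular for \<open>\<lless>\<close>. The first identity gives \<open>\<theta>\<^sub>S = det N\<close>; restricting the
  second to a block gives that the blocks of \<open>N\<close> and of the table of \<open>*\<close> have equal determinants.
\<close>

subsection \<open>Finite semigroups\<close>

text \<open>In a subsemigroup \<open>B\<close> of least size, \<open>B * e = B\<close>, so some
  \<open>f\<close> in \<open>B\<close> fixes \<open>e\<close> on the left. The elements fixing
  \<open>e\<close> on the left then form a subsemigroup, hence all of \<open>B\<close>, and
  \<open>e\<close> is one of them.\<close>

lemma finite_semigroup_has_idempotent:
  fixes A :: "'a::{finite,semigroup_mult} set"
  assumes "A \<noteq> {}" and "\<And>a b. a \<in> A \<Longrightarrow> b \<in> A \<Longrightarrow> a * b \<in> A"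
  shows "\<exists>e\<in>A. e * e = e"
proof -
  let ?P = "\<lambda>B. B \<subseteq> A \<and> B \<noteq> {} \<and> (\<forall>a\<in>B. \<forall>b\<in>B. a * b \<in> B)"
  have "?P A" using assms by auto
  then obtain B where B: "?P B" and least: "\<And>C. ?P C \<Longrightarrow> card B \<le> card C"
    using ex_has_least_nat[of ?P A card] by blast
  have minimal: "C = B" if "?P C" "C \<subseteq> B" for C
    using least[OF that(1)] that(2) by (metis card_seteq finite)
  obtain e where e: "e \<in> B" using B by blast
  have closed: "a * b \<in> B" if "a \<in> B" "b \<in> B" for a b using B that by blast
  have "(\<lambda>x. x * e) ` B = B"
  proof (rule minimal)
    show "?P ((\<lambda>x. x * e) ` B)"
    proof (intro conjI)
      show "(\<lambda>x. x * e) ` B \<subseteq> A" using B closed e by blast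
      show "\<forall>a\<in>(\<lambda>x. x * e) ` B. \<forall>b\<in>(\<lambda>x. x * e) ` B. a * b \<in> (\<lambda>x. x * e) ` B"
      proof clarify
        fix x y assume "x \<in> B" "y \<in> B"
        then have "x * e * y \<in> B" by (intro closed e)
        then show "x * e * (y * e) \<in> (\<lambda>x. x * e) ` B"
          by (rule rev_image_eqI) (simp add: mult.assoc)
      qed
    qed (use B in auto)
  qed (use closed e in auto)
  then obtain f where f: "f \<in> B" "f * e = e" using e by (metis imageE)
  have "{x \<in> B. x * e = e} = B"
    by (rule minimal) (use B f closed in \<open>auto simp: mult.assoc\<close>)
  then have "e * e = e" using e by blast
  then show ?thesis using e B by blast
qed

text \<open>Two ideals share the products of their elements, so their intersection is an ideal and
  two minimal ones agree. This gives meaning to the \<open>THE\<close> in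
  \<open>kernel\<close>.\<close>

lemma ex1_minimal_ideal:
  fixes T :: "'a::{finite,semigroup_mult} set"
  assumes "T \<noteq> {}" and closed: "\<And>a b. a \<in> T \<Longrightarrow> b \<in> T \<Longrightarrow> a * b \<in> T"
  shows "\<exists>!K. semigroup_ideal T K \<and> (\<forall>J. semigroup_ideal T J \<and> J \<subseteq> K \<longrightarrow> J = K)"
proof (rule ex_ex1I)
  have "semigroup_ideal T T" using assms by (auto simp: semigroup_ideal_def)
  then obtain K where K: "semigroup_ideal T K"
    and least: "\<And>J. semigroup_ideal T J \<Longrightarrow> card K \<le> card J"
    using ex_has_least_nat[of "semigroup_ideal T" T card] by blast
  have "J = K" if "semigroup_ideal T J" "J \<subseteq> K" for J
    using least[OF that(1)] that(2) by (intro card_seteq) auto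
  then show "\<exists>K. semigroup_ideal T K \<and> (\<forall>J. semigroup_ideal T J \<and> J \<subseteq> K \<longrightarrow> J = K)"
    using K by blast
next
  fix K L
  assume K: "semigroup_ideal T K \<and> (\<forall>J. semigroup_ideal T J \<and> J \<subseteq> K \<longrightarrow> J = K)"
    and L: "semigroup_ideal T L \<and> (\<forall>J. semigroup_ideal T J \<and> J \<subseteq> L \<longrightarrow> J = L)"
  obtain k l where "k \<in> K" "l \<in> L" using K L by (auto simp: semigroup_ideal_def)
  have ideals: "semigroup_ideal T K" "semigroup_ideal T L" using K L by blast+
  then have "k * l \<in> K \<inter> L"
    using \<open>k \<in> K\<close> \<open>l \<in> L\<close> unfolding semigroup_ideal_def by blast
  then have "semigroup_ideal T (K \<inter> L)"
    using ideals unfolding semigroup_ideal_def by blast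
  then have "K \<inter> L = K" "K \<inter> L = L" using K L by (meson Int_lower1 Int_lower2)+
  then show "K = L" by simp
qed

text \<open>A one-element ideal absorbs multiplication from both sides, so its element is the zero
  of the generated subsemigroup.\<close>

lemma singleton_kernel_is_zero:
  fixes A :: "'a::{finite,semigroup_mult} set"
  defines "T \<equiv> subsemigroup_gen A"
  assumes "A \<noteq> {}" and "card (kernel T) = 1"
  shows "the_elem (kernel T) \<in> T"
    and "a \<in> T \<Longrightarrow> a * the_elem (kernel T) = the_elem (kernel T)"
    and "a \<in> T \<Longrightarrow> the_elem (kernel T) * a = the_elem (kernel T)"
proof -
  have "T \<noteq> {}" using \<open>A \<noteq> {}\<close> subsemigroup_gen.base unfolding T_def by blast
  moreover have "a * b \<in> T" if "a \<in> T" "b \<in> T" for a b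
    using that unfolding T_def by (rule subsemigroup_gen.mult)
  ultimately have "semigroup_ideal T (kernel T)"
    using theI'[OF ex1_minimal_ideal] unfolding kernel_def by blast
  moreover obtain z where "kernel T = {z}" using assms(3) by (auto simp: card_1_singleton_iff)
  ultimately have "semigroup_ideal T {the_elem (kernel T)}" by simp
  then show "the_elem (kernel T) \<in> T"
    "a \<in> T \<Longrightarrow> a * the_elem (kernel T) = the_elem (kernel T)"
    "a \<in> T \<Longrightarrow> the_elem (kernel T) * a = the_elem (kernel T)"
    by (auto simp: semigroup_ideal_def)
qed

section \<open>Idempotent local identities from the unit of the semigroup algebra\<close>

lemma lookup_scale [simp]: "Poly_Mapping.lookup (scale c f) u = c * Poly_Mapping.lookup f u"
  by (simp add: scale_def map.rep_eq when_def)

lemma lookup_basis: "Poly_Mapping.lookup (basis s) u = (if s = u then 1 else 0)"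
  by (simp add: basis_def lookup_single when_def)

text \<open>Comparing coefficients of \<open>s\<close> in \<open>s = s * u\<close>, with
  \<open>u\<close> the unit, shows that \<open>s * t = s\<close> for some \<open>t\<close>. Such
  \<open>t\<close> form a subsemigroup, which contains an idempotent. The other side is
  dual.\<close>

lemma unital_imp_local_identities:
  assumes "salg_unital TYPE('a::{finite,semigroup_mult})"
  shows "phi_star (s :: 'a) \<noteq> {}" and "phi_plus s \<noteq> {}"
proof -
  obtain u :: "'a salg" where u: "\<And>f. salg_mult u f = f" "\<And>f. salg_mult f u = f"
    using assms unfolding salg_unital_def by blast
  have "\<exists>t. s * t = s"
  proof (rule ccontr)
    assume no: "\<nexists>t. s * t = s"
    have "(1::complex) = Poly_Mapping.lookup (salg_mult (basis s) u) s"
      by (simp add: u lookup_basis)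
    also have "\<dots> = (\<Sum>a\<in>UNIV. \<Sum>t\<in>UNIV. Poly_Mapping.lookup (basis s) a *
        Poly_Mapping.lookup u t * Poly_Mapping.lookup (basis (a * t)) s)"
      by (simp add: salg_mult_def bilin_ext_def lookup_sum)
    also have "\<dots> = 0"
      using no by (intro sum.neutral ballI) (auto simp: lookup_basis)
    finally show False by simp
  qed
  then show "phi_star s \<noteq> {}"
    using finite_semigroup_has_idempotent[of "{t. s * t = s}"]
    by (auto simp: phi_star_def idempotents_def mult.assoc[symmetric])
  have "\<exists>t. t * s = s"
  proof (rule ccontr)
    assume no: "\<nexists>t. t * s = s"
    have "(1::complex) = Poly_Mapping.lookup (salg_mult u (basis s)) s"
      by (simp add: u lookup_basis)
    also have "\<dots> = (\<Sum>t\<in>UNIV. \<Sum>a\<in>UNIV. Poly_Mapping.lookup u t *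
        Poly_Mapping.lookup (basis s) a * Poly_Mapping.lookup (basis (t * a)) s)"
      by (simp add: salg_mult_def bilin_ext_def lookup_sum)
    also have "\<dots> = 0"
      using no by (intro sum.neutral ballI) (auto simp: lookup_basis)
    finally show False by simp
  qed
  then show "phi_plus s \<noteq> {}"
    using finite_semigroup_has_idempotent[of "{t. t * s = s}"]
    by (auto simp: phi_plus_def idempotents_def mult.assoc)
qed

subsection \<open>Singleton-rich and smooth semigroups\<close>

locale singleton_rich_semigroup =
  fixes dom :: "'a::{finite,semigroup_mult} itself"
  assumes rich: "singleton_rich TYPE('a)" and unital: "salg_unital TYPE('a)"
begin

text \<open>\<open>sstar s\<close> is the zero of a subsemigroup all of whose elements fix
  \<open>s\<close> on the right; so it fixes \<open>s\<close> and lies below every idempotent that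
  does. From here on these properties and their duals replace the kernels.\<close>

lemma sstar_props:
  fixes s :: 'a
  shows "s * sstar s = s" and "sstar s * sstar s = sstar s"
    and "f * f = f \<Longrightarrow> s * f = s \<Longrightarrow> sstar s * f = sstar s"
    and "f * f = f \<Longrightarrow> s * f = s \<Longrightarrow> f * sstar s = sstar s"
proof -
  let ?T = "subsemigroup_gen (phi_star s)"
  have "card (kernel ?T) = 1" using rich by (simp add: singleton_rich_def star_kernel_def)
  note zero = singleton_kernel_is_zero[OF unital_imp_local_identities(1)[OF unital] this,
      folded star_kernel_def, folded sstar_def]
  have "s * t = s" if "t \<in> ?T" for t
    using that by induction (auto simp: phi_star_def mult.assoc[symmetric])
  then show "s * sstar s = s" using zero(1) by blast
  show "sstar s * sstar s = sstar s" using zero by blast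
  assume "f * f = f" "s * f = s"
  then have "f \<in> ?T" by (intro subsemigroup_gen.base) (simp add: phi_star_def idempotents_def)
  then show "sstar s * f = sstar s" "f * sstar s = sstar s" using zero by blast+
qed

lemma splus_props:
  fixes s :: 'a
  shows "splus s * s = s" and "splus s * splus s = splus s"
    and "f * f = f \<Longrightarrow> f * s = s \<Longrightarrow> splus s * f = splus s"
    and "f * f = f \<Longrightarrow> f * s = s \<Longrightarrow> f * splus s = splus s"
proof -
  let ?T = "subsemigroup_gen (phi_plus s)"
  have "card (kernel ?T) = 1" using rich by (simp add: singleton_rich_def plus_kernel_def)
  note zero = singleton_kernel_is_zero[OF unital_imp_local_identities(2)[OF unital] this,
      folded plus_kernel_def, folded splus_def]
  have "t * s = s" if "t \<in> ?T" for t
    using that by induction (auto simp: phi_plus_def mult.assoc)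
  then show "splus s * s = s" using zero(1) by blast
  show "splus s * splus s = splus s" using zero by blast
  assume "f * f = f" "f * s = s"
  then have "f \<in> ?T" by (intro subsemigroup_gen.base) (simp add: phi_plus_def idempotents_def)
  then show "splus s * f = splus s" "f * splus s = splus s" using zero by blast+
qed

lemma sstar_idem [simp]: "sstar (s :: 'a) * sstar s = sstar s"
  and splus_idem [simp]: "splus s * splus s = splus s"
  and mult_sstar [simp]: "s * sstar s = s"
  and splus_mult [simp]: "splus s * s = s"
  using sstar_props splus_props by blast+

lemma mult_sstar_left [simp]: "s * (sstar s * t) = s * (t :: 'a)"
  and splus_mult_left [simp]: "splus s * (s * t) = s * (t :: 'a)"
  and sstar_idem_left [simp]: "sstar s * (sstar s * t) = sstar s * (t :: 'a)"
  and splus_idem_left [simp]: "splus s * (splus s * t) = splus s * (t :: 'a)"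
  by (simp_all add: mult.assoc[symmetric])

lemma sstar_idempotent:
  assumes "e * e = e" shows "sstar (e :: 'a) = e"
  using sstar_props(1)[of e] sstar_props(4)[of e e] assms by simp

lemma splus_idempotent:
  assumes "e * e = e" shows "splus (e :: 'a) = e"
  using splus_props(1)[of e] splus_props(3)[of e e] assms by simp

section \<open>Reflexivity and antisymmetry of \<open>\<lless>\<close>\<close>

lemma ll_refl: "(s :: 'a) \<lless> s"
  by (simp add: ll_def)

text \<open>Substituting one relation into the other writes \<open>s\<close> as
  \<open>p * s * q\<close> with \<open>p = splus s * splus t\<close>. Iteration yields an idempotent
  that fixes \<open>s\<close> on the left and absorbs \<open>splus t\<close>, and minimality of
  \<open>splus s\<close> finishes. The second claim is dual.\<close>

lemma ll_antisym_aux: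
  fixes s t :: 'a
  assumes "s \<lless> t" "t \<lless> s"
  shows "splus s * splus t = splus s" and "sstar t * sstar s = sstar s"
proof -
  have st: "splus s * (splus t * (s * (sstar t * sstar s))) = s"
    using assms unfolding ll_def by (metis mult.assoc)
  \<comment> \<open>The factors that bring some \<open>s * y\<close> back to \<open>s\<close>. If
    \<open>y\<close> and \<open>z\<close> serve for \<open>a\<close> and \<open>b\<close>, then
    \<open>z * y\<close> serves for \<open>a * b\<close>.\<close>
  let ?A = "{x. (\<exists>y. x * (s * y) = s) \<and> splus s * x = x \<and> x * splus t = x}"
  have "\<exists>e\<in>?A. e * e = e"
  proof (rule finite_semigroup_has_idempotent)
    have "splus s * splus t \<in> ?A" using st by (auto simp: mult.assoc)
    then show "?A \<noteq> {}" by blast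
    fix a b assume "a \<in> ?A" "b \<in> ?A"
    then obtain y z where "a * (s * y) = s" "b * (s * z) = s"
      "splus s * a = a" "b * splus t = b" by blast
    moreover from this have "a * (b * (s * (z * y))) = s" by (metis mult.assoc)
    ultimately show "a * b \<in> ?A" by (auto simp: mult.assoc simp flip: mult.assoc[of "splus s"])
  qed
  then obtain e y where e: "e * e = e" "e * (s * y) = s" "splus s * e = e" "e * splus t = e" by blast
  then have "e * s = s" by (metis mult.assoc)
  then show "splus s * splus t = splus s" using e splus_props(3)[of e s] by simp
  let ?B = "{x. (\<exists>y. y * s * x = s) \<and> x * sstar s = x \<and> sstar t * x = x}"
  have "\<exists>e\<in>?B. e * e = e"
  proof (rule finite_semigroup_has_idempotent)
    have "(splus s * splus t) * s * (sstar t * sstar s) = s" using st by (simp add: mult.assoc)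
    then have "\<exists>y. y * s * (sstar t * sstar s) = s" by blast
    then have "sstar t * sstar s \<in> ?B" by (simp add: mult.assoc)
    then show "?B \<noteq> {}" by blast
    fix a b assume "a \<in> ?B" "b \<in> ?B"
    then obtain y z where "y * s * a = s" "z * s * b = s"
      "sstar t * a = a" "b * sstar s = b" by blast
    moreover from this have "(z * y) * s * (a * b) = s" by (metis mult.assoc)
    moreover from this have "\<exists>y. y * s * (a * b) = s" by blast
    ultimately show "a * b \<in> ?B" by (simp add: mult.assoc) (simp flip: mult.assoc[of "sstar t"])
  qed
  then obtain e y where e: "e * e = e" "y * s * e = s" "e * sstar s = e" "sstar t * e = e" by blast
  then have "s * e = s" by (metis mult.assoc)
  then show "sstar t * sstar s = sstar s" using e sstar_props(4)[of e s] by simp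
qed

text \<open>An idempotent equals its own \<open>sstar\<close> and \<open>splus\<close>, so their
  absorption laws apply to it. Hence \<open>e * f = e\<close> and \<open>f * e = e\<close> express
  the same order on idempotents.\<close>

lemma idempotent_absorb:
  fixes e f :: 'a
  assumes "e * e = e" "f * f = f"
  shows "e * f = e \<Longrightarrow> f * e = e" and "f * e = e \<Longrightarrow> e * f = e"
  using sstar_props(4)[of f e] splus_props(3)[of f e] sstar_idempotent splus_idempotent assms by auto

lemma ll_antisym:
  fixes s t :: 'a
  assumes "s \<lless> t" "t \<lless> s"
  shows "s = t"
proof -
  have "splus s = splus t"
    using ll_antisym_aux(1)[OF assms] ll_antisym_aux(1)[OF assms(2,1)]
    using idempotent_absorb(1)[of "splus s" "splus t"] by simp
  moreover have "sstar s = sstar t"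
    using ll_antisym_aux(2)[OF assms] ll_antisym_aux(2)[OF assms(2,1)]
    using idempotent_absorb(2)[of "sstar s" "sstar t"] by simp
  ultimately show ?thesis
    using assms(1) by (simp add: ll_def mult.assoc)
qed

section \<open>Factorisation of elements below a product\<close>

lemma splus_factor:
  fixes a b :: 'a
  assumes "splus (a * b) * a = a"
  shows "splus a = splus (a * b)"
proof -
  have "splus a * splus (a * b) = splus a"
    by (rule splus_props(3)) (use assms in simp_all)
  moreover have "splus (a * b) = splus a * splus (a * b)"
    by (rule splus_props(4)[symmetric]) (simp_all)
  ultimately show ?thesis by simp
qed

lemma sstar_factor:
  fixes a b :: 'a
  assumes "b * sstar (a * b) = b"
  shows "sstar b = sstar (a * b)"
proof -
  have "sstar (a * b) * sstar b = sstar b"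
    by (rule sstar_props(4)) (use assms in simp_all)
  moreover have "sstar (a * b) = sstar (a * b) * sstar b"
    by (rule sstar_props(3)[symmetric]) (simp_all add: mult.assoc)
  ultimately show ?thesis by simp
qed

lemma descending_idempotents_stabilise:
  fixes g :: "nat \<Rightarrow> 'a"
  assumes idem: "\<And>i. g i * g i = g i" and desc: "\<And>i. g (Suc i) * g i = g (Suc i)"
  shows "\<exists>n. \<forall>m\<ge>n. g m = g n"
proof -
  have le: "g m * g n = g m \<and> g n * g m = g m" if "n \<le> m" for m n
    using that
  proof (induction m rule: dec_induct)
    case base
    show ?case by (simp add: idem)
  next
    case (step m)
    have "g m * g (Suc m) = g (Suc m)" by (rule idempotent_absorb) (use idem desc in auto)
    then show ?case using step desc by (metis mult.assoc)
  qed
  \<comment> \<open>The sets of elements below \<open>g i\<close> shrink with \<open>i\<close>; once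
    one has least size, it stays constant.\<close>
  let ?D = "\<lambda>i. {e. e * g i = e \<and> g i * e = e}"
  obtain n where n: "\<And>m. card (?D n) \<le> card (?D m)"
    using ex_has_least_nat[of "\<lambda>_. True" 0 "\<lambda>i. card (?D i)"] by blast
  have "g m = g n" if "n \<le> m" for m
  proof -
    have "?D m \<subseteq> ?D n"
      using le[OF that] by (auto) (metis mult.assoc)+
    then have "?D m = ?D n" using n by (simp add: card_seteq)
    then have "g n \<in> ?D m" using idem by auto
    then show ?thesis using le[OF that] by simp
  qed
  then show ?thesis by blast
qed

text \<open>Let \<open>a i\<close>, \<open>b i\<close> be the iterates,
  \<open>h i = sstar (a i)\<close>, and \<open>c i\<close> the value of \<open>phi\<close>. The
  product \<open>a i * b i\<close> never changes, and the idempotents interlace: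
  \<open>h i \<ge> c i \<ge> h (Suc i)\<close>. Both chains therefore settle at \<open>g\<close>,
  where the iterates are \<open>x * g\<close> and \<open>g * y\<close>.\<close>

lemma phi_lim_factorisation:
  fixes x y :: 'a
  defines "g \<equiv> phi_lim x y"
  assumes x: "splus (x * y) * x = x" and y: "y * sstar (x * y) = y"
  shows "sstar (x * g) = g" and "splus (g * y) = g" and "(x * g) * (g * y) = x * y"
    and "splus (x * g) = splus (x * y)" and "sstar (g * y) = sstar (x * y)"
proof -
  define a where "a i = fst (phi_seq x y i)" for i
  define b where "b i = snd (phi_seq x y i)" for i
  define h where "h i = sstar (a i)" for i
  define c where "c i = phi (a i) (b i)" for i
  have a0: "a 0 = x" and b0: "b 0 = y" by (simp_all add: a_def b_def)
  have aS: "a (Suc i) = a i * c i" and bS: "b (Suc i) = h i * b i" for i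
    by (simp_all add: a_def b_def c_def h_def Let_def case_prod_beta)
  have c: "c i = splus (h i * b i)" for i by (simp add: c_def phi_def h_def)
  have idem [simp]: "h i * h i = h i" "c i * c i = c i" for i by (simp_all add: h_def c)
  have ab: "a i * b i = x * y" for i
  proof (induction i)
    case (Suc i)
    have "a i * c i * (h i * b i) = a i * (h i * b i)" by (simp add: c mult.assoc)
    also have "\<dots> = a i * b i" by (simp add: h_def)
    finally show ?case using Suc by (simp add: aS bS)
  qed (simp add: a0 b0)
  \<comment> \<open>The outer identities of \<open>x * y\<close> survive every iteration; in the end
    they fix \<open>splus\<close> of the left factor and \<open>sstar\<close> of the right
    one.\<close>
  have pa: "splus (x * y) * a i = a i" for i
  proof (induction i)
    case (Suc i)
    then show ?case by (simp add: aS mult.assoc[symmetric])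
  qed (simp add: a0 x)
  have bq: "b i * sstar (x * y) = b i" for i
    by (induction i) (simp_all add: b0 y bS mult.assoc)
  have ch: "c i * h i = c i" for i
    unfolding c by (rule splus_props(3)) (simp_all add: h_def)
  have hc: "c i * h (Suc i) = h (Suc i)" for i
    unfolding h_def by (rule sstar_props(4)) (simp_all add: aS mult.assoc)
  have hc': "h (Suc i) * c i = h (Suc i)" and ch': "h i * c i = c i" for i
    by (rule idempotent_absorb; simp add: hc ch)+
  have cc: "c (Suc i) * c i = c (Suc i)" for i
    using ch[of "Suc i"] hc'[of i] by (metis mult.assoc)
  have cc': "c i * c (Suc i) = c (Suc i)" for i
    by (rule idempotent_absorb) (simp_all add: cc)
  have hh: "h (Suc i) * h i = h (Suc i)" for i
    using ch[of i] hc'[of i] by (metis mult.assoc)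
  have a: "a (Suc i) = x * c i" for i
    by (induction i) (simp_all add: aS a0 cc' mult.assoc)
  have b: "b (Suc i) = h i * y" for i
  proof (induction i)
    case (Suc i)
    then show ?case using hh[of i] bS[of "Suc i"] by (simp add: mult.assoc[symmetric])
  qed (simp add: bS b0)
  obtain n where n: "\<And>m. m \<ge> n \<Longrightarrow> c m = c n"
    using descending_idempotents_stabilise[of c] cc by auto
  have ev: "eventually (\<lambda>i. c i = c n) sequentially"
    unfolding eventually_sequentially using n by blast
  have "g = c n"
    unfolding g_def phi_lim_def
  proof (rule the_equality)
    show "\<forall>\<^sub>F i in sequentially. phi (fst (phi_seq x y i)) (snd (phi_seq x y i)) = c n"
      using ev by (simp add: c_def a_def b_def)
    fix e assume "\<forall>\<^sub>F i in sequentially. phi (fst (phi_seq x y i)) (snd (phi_seq x y i)) = e"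
    then have "\<forall>\<^sub>F i in sequentially. c i = e" by (simp add: c_def a_def b_def)
    with ev have "\<forall>\<^sub>F i in sequentially. c i = c n \<and> c i = e" by (rule eventually_conj)
    then show "e = c n" by (auto simp: eventually_sequentially)
  qed
  \<comment> \<open>\<open>h (Suc n)\<close> is squeezed between \<open>c (Suc n)\<close> and
    \<open>c n\<close>, which agree.\<close>
  have h: "h (Suc n) = g"
    using hc'[of n] ch'[of "Suc n"] n[of "Suc n"] \<open>g = c n\<close> by simp
  \<comment> \<open>\<open>b\<close> lags behind \<open>a\<close>: its value involves the preceding
    \<open>h\<close>, so it is known to be \<open>g * y\<close> only one step later.\<close>
  have aN: "a (Suc n) = x * g" and aN': "a (Suc (Suc n)) = x * g" and bN: "b (Suc (Suc n)) = g * y"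
    using a b h n[of "Suc n"] \<open>g = c n\<close> by simp_all
  show "sstar (x * g) = g" using h aN by (simp add: h_def)
  show "splus (g * y) = g"
    using c[of "Suc n"] n[of "Suc n"] bN bS[of "Suc n"] \<open>g = c n\<close> by simp
  show eq: "(x * g) * (g * y) = x * y" using ab[of "Suc (Suc n)"] aN' bN by simp
  show "splus (x * g) = splus (x * y)"
    using splus_factor[of "x * g" "g * y"] pa[of "Suc n"] aN eq by simp
  show "sstar (g * y) = sstar (x * y)"
    using sstar_factor[of "g * y" "x * g"] bq[of "Suc (Suc n)"] bN eq by simp
qed

text \<open>Existence half of the factorisation: \<open>u = (splus u * s) * (t * sstar u)\<close>,
  and \<open>phi_lim_factorisation\<close> splits this at \<open>g\<close>. The factors keep
  \<open>splus u\<close> and \<open>sstar u\<close>, so the limit belonging to them is again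
  \<open>g\<close>.\<close>

lemma ll_product_factorisation:
  fixes u s t :: 'a
  assumes "u \<lless> s * t"
  obtains s' t' where "s' \<lless> s" "t' \<lless> t" "s' * t' = u" "splus s' = splus u" "sstar t' = sstar u"
    "sstar s' = splus t'" "phi_lim (splus s' * s) (t * sstar t') = splus t'"
proof -
  let ?x = "splus u * s" and ?y = "t * sstar u"
  define g where "g = phi_lim ?x ?y"
  have u: "?x * ?y = u" using assms by (simp add: ll_def mult.assoc)
  note F = phi_lim_factorisation[of ?x ?y, folded g_def, unfolded u]
  have "splus u * ?x = ?x" "?y * sstar u = ?y" by (simp_all add: mult.assoc)
  note F = F[OF this]
  show thesis
  proof (rule that[of "?x * g" "g * ?y"])
    show "?x * g \<lless> s" using F by (simp add: ll_def mult.assoc)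
    show "g * ?y \<lless> t" using F by (simp add: ll_def mult.assoc)
  qed (use F in \<open>simp_all add: g_def\<close>)
qed

end

section \<open>Smoothness and the multiplicativity of \<open>Z\<close>\<close>

abbreviation sharp_dom :: "'a::semigroup_mult \<Rightarrow> 'a \<Rightarrow> bool" where
  "sharp_dom s t \<equiv> splus s = splus (s * t) \<and> sstar t = sstar (s * t) \<and> sstar s = splus t"

lemma basis_nonzero: "basis s \<noteq> 0"
  by (metis lookup_basis lookup_zero zero_neq_one)

lemma sharp_nonzero_iff: "sharp s t \<noteq> 0 \<longleftrightarrow> sharp_dom s t"
  by (simp add: sharp_def basis_nonzero)

text \<open>In a smooth semigroup the condition under which the pair \<open>s' \<lless> s\<close>, \<open>t' \<lless> t\<close> contributes
  to \<open>star_Z s t\<close> involves \<open>s'\<close> and \<open>s\<close> only; it is the following relation.\<close>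

definition strong_ll :: "'a::semigroup_mult \<Rightarrow> 'a \<Rightarrow> bool" where
  "strong_ll s' s \<longleftrightarrow> s' \<lless> s \<and> s' * sstar (splus s' * s) = s'"

locale smooth_semigroup =
  fixes dom :: "'a::{finite,semigroup_mult} itself"
  assumes smooth: "ll_smooth TYPE('a)" and unital': "salg_unital TYPE('a)"

sublocale smooth_semigroup \<subseteq> singleton_rich_semigroup
  using smooth unital' by unfold_locales (simp_all add: ll_smooth_def)

context smooth_semigroup
begin

lemma ll_trans: "r \<lless> s \<Longrightarrow> s \<lless> t \<Longrightarrow> r \<lless> (t :: 'a)"
  using smooth by (auto simp: ll_smooth_def ll_transitive_def)

lemma strong_ll_refl: "strong_ll s (s :: 'a)"
  by (simp add: strong_ll_def ll_refl)

text \<open>The first smoothness condition, on chains whose upper two elements coincide.\<close>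

lemma phi_lim_eq_phi:
  fixes s t :: 'a
  assumes "s' \<lless> s" "t' \<lless> t" "sharp_dom s' t'"
  shows "phi_lim (splus s' * s) (t * sstar t') = phi (splus s' * s) (t * sstar t')"
  using smooth assms ll_refl sharp_nonzero_iff[of s' t'] unfolding ll_smooth_def by blast

text \<open>The limit is \<open>splus (f * (t * sstar t'))\<close> with
  \<open>f = sstar (splus s' * s)\<close>. If it is \<open>e = sstar s'\<close>, then
  \<open>e * f = e\<close>, so \<open>f\<close> fixes \<open>s'\<close> on the right. Conversely,
  \<open>s' * f = s'\<close> puts \<open>e\<close> below \<open>f\<close>, so \<open>f\<close> fixes
  \<open>t'\<close> on the left, and smoothness carries this over to \<open>t\<close>.\<close>

lemma phi_lim_eq_iff_strong_ll:
  fixes s t :: 'a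
  assumes st: "s' \<lless> s" "t' \<lless> t" "sharp_dom s' t'"
  shows "phi_lim (splus s' * s) (t * sstar t') = splus t' \<longleftrightarrow> strong_ll s' s" (is "?lhs \<longleftrightarrow> ?rhs")
    and "strong_ll s' s \<Longrightarrow> sstar (splus s' * s) * (t * sstar t') = t'"
proof -
  define e where "e = splus t'"
  define f where "f = sstar (splus s' * s)"
  have e: "sstar s' = e" "e * e = e" using st by (simp_all add: e_def)
  have f: "f * f = f" by (simp add: f_def)
  have phi: "phi_lim (splus s' * s) (t * sstar t') = splus (f * (t * sstar t'))"
    using phi_lim_eq_phi[OF assms] by (simp add: phi_def f_def)
  have transported: "f * (t * sstar t') = t'" if "strong_ll s' s"
  proof -
    have "s' * f = s'" using that by (simp add: strong_ll_def f_def)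
    then have "f * e = e" using sstar_props(4)[of f s'] f e by simp
    then have "f * t' = t'" by (metis e_def splus_mult mult.assoc)
    then have "sstar (splus s' * s) * t' * sstar t' = t'" by (simp add: f_def)
    \<comment> \<open>The second smoothness condition, on the chain
      \<open>t' \<lless> t' \<lless> t\<close>.\<close>
    moreover have "sstar (splus s' * s) * t' * sstar t' = t' \<longleftrightarrow>
        sstar (splus s' * s) * t * sstar t' = t'"
      using smooth assms ll_refl sharp_nonzero_iff[of s' t'] unfolding ll_smooth_def by blast
    ultimately show ?thesis by (simp add: f_def mult.assoc)
  qed
  then show "strong_ll s' s \<Longrightarrow> sstar (splus s' * s) * (t * sstar t') = t'"
    by (simp add: f_def)
  show "?lhs \<longleftrightarrow> ?rhs"
  proof
    assume ?lhs
    then have "splus (f * (t * sstar t')) = e" using phi by (simp add: e_def)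
    then have "e * f = e"
      using splus_props(3)[of f "f * (t * sstar t')"] f by (simp add: mult.assoc[symmetric])
    then have "s' * f = s'" using e by (metis mult_sstar mult.assoc)
    then show ?rhs using st by (simp add: strong_ll_def f_def)
  next
    assume ?rhs
    then show ?lhs using phi transported by simp
  qed
qed

lemma star_Z_eq: "star_Z s (t :: 'a) = (\<Sum>s' | strong_ll s' s. \<Sum>t' | t' \<lless> t. sharp s' t')"
proof -
  have "(\<Sum>t' | t' \<lless> t. sharp_at (phi_lim (splus s' * s) (t * sstar t')) s' t') =
      (if strong_ll s' s then \<Sum>t' | t' \<lless> t. sharp s' t' else 0)" if "s' \<lless> s" for s'
  proof -
    have "sharp_at (phi_lim (splus s' * s) (t * sstar t')) s' t' =
        (if strong_ll s' s then sharp s' t' else 0)" if "t' \<lless> t" for t'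
      using phi_lim_eq_iff_strong_ll(1)[OF \<open>s' \<lless> s\<close> that]
      by (auto simp: sharp_at_def sharp_def)
    then show ?thesis by simp
  qed
  then have "star_Z s t =
      (\<Sum>s' | s' \<lless> s. if strong_ll s' s then \<Sum>t' | t' \<lless> t. sharp s' t' else 0)"
    by (simp add: star_Z_def)
  also have "\<dots> = (\<Sum>s' | strong_ll s' s. \<Sum>t' | t' \<lless> t. sharp s' t')"
    by (subst sum.inter_filter[symmetric]) (auto intro!: sum.cong simp: strong_ll_def)
  finally show ?thesis .
qed

text \<open>Surjectivity is \<open>ll_product_factorisation\<close>. For injectivity,
  \<open>u = s' * t'\<close> has \<open>splus u = splus s'\<close> and
  \<open>sstar u = sstar t'\<close>, so \<open>u\<close> determines
  \<open>t' = sstar (splus u * s) * (t * sstar u)\<close> and then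
  \<open>s' = splus u * s * splus t'\<close>.\<close>

lemma bij_betw_ll_product:
  fixes s t :: 'a
  shows "bij_betw (\<lambda>(s', t'). s' * t') {(s', t'). strong_ll s' s \<and> t' \<lless> t \<and> sharp_dom s' t'}
    {u. u \<lless> s * t}" (is "bij_betw ?m ?Q _")
proof (rule bij_betw_imageI)
  have Q: "s' = splus (s' * t') * s * splus t'" "sstar (splus (s' * t') * s) * (t * sstar (s' * t')) = t'"
    if "(s', t') \<in> ?Q" for s' t'
    using phi_lim_eq_iff_strong_ll(2)[of s' s t' t] that by (auto simp: strong_ll_def ll_def)
  show "inj_on ?m ?Q"
  proof (rule inj_onI)
    fix p q assume pq: "p \<in> ?Q" "q \<in> ?Q" "?m p = ?m q"
    obtain a b a' b' where p: "p = (a, b)" and q: "q = (a', b')" by (cases p, cases q)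
    have mem: "(a, b) \<in> ?Q" "(a', b') \<in> ?Q" and eq: "a * b = a' * b'"
      using pq unfolding p q by simp_all
    have "b = sstar (splus (a * b) * s) * (t * sstar (a * b))" by (rule Q(2)[OF mem(1), symmetric])
    also have "\<dots> = b'" unfolding eq by (rule Q(2)[OF mem(2)])
    finally have "b = b'" .
    have "a = splus (a * b) * s * splus b" by (rule Q(1)[OF mem(1)])
    also have "\<dots> = splus (a' * b') * s * splus b'" unfolding eq unfolding \<open>b = b'\<close> by (rule refl)
    also have "\<dots> = a'" by (rule Q(1)[OF mem(2), symmetric])
    finally show "p = q" using \<open>b = b'\<close> p q by simp
  qed
  show "?m ` ?Q = {u. u \<lless> s * t}"
  proof (intro equalityI subsetI)
    fix u assume "u \<in> ?m ` ?Q"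
    then obtain a b where ab: "strong_ll a s" "b \<lless> t" "sharp_dom a b" "u = a * b" by auto
    then have mem: "(a, b) \<in> ?Q" by blast
    have Q': "a = splus u * s * splus b" "sstar (splus u * s) * (t * sstar u) = b"
      unfolding ab(4) by (rule Q[OF mem])+
    \<comment> \<open>Inserting \<open>sstar (splus u * s)\<close> in front of \<open>t\<close> is
      harmless and turns the right half into \<open>b\<close>.\<close>
    have "splus u * (s * t) * sstar u = splus u * s * (sstar (splus u * s) * (t * sstar u))"
      by (subst mult_sstar_left) (simp add: mult.assoc)
    also have "\<dots> = splus u * s * b" by (simp only: Q'(2))
    also have "\<dots> = splus u * s * splus b * b" by (simp add: mult.assoc)
    also have "\<dots> = u" unfolding Q'(1)[symmetric] by (simp only: ab(4))
    finally show "u \<in> {u. u \<lless> s * t}" by (simp add: ll_def)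
  next
    fix u assume "u \<in> {u. u \<lless> s * t}"
    then obtain a b where "a \<lless> s" "b \<lless> t" "a * b = u" "sharp_dom a b"
      "phi_lim (splus a * s) (t * sstar b) = splus b"
      by (auto elim!: ll_product_factorisation)
    then have "(a, b) \<in> ?Q" using phi_lim_eq_iff_strong_ll(1)[of a s b t] by auto
    then show "u \<in> ?m ` ?Q" using \<open>a * b = u\<close> by force
  qed
qed

text \<open>The left side is \<open>Z\<close> of \<open>s * t\<close>, so \<open>Z\<close> carries
  the semigroup product to \<open>star_mult\<close>. Pairs outside \<open>sharp_dom\<close>
  contribute zero.\<close>

lemma sum_ll_product_eq_star_Z:
  fixes s t :: 'a
  shows "(\<Sum>u | u \<lless> s * t. basis u) = star_Z s t"
proof -
  have "(\<Sum>u | u \<lless> s * t. basis u) = (\<Sum>(s', t') \<in> {(s', t'). strong_ll s' s \<and> t' \<lless> t \<and>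
      sharp_dom s' t'}. basis (s' * t'))"
    by (subst sum.reindex_bij_betw[OF bij_betw_ll_product, symmetric]) (simp add: case_prod_beta')
  also have "\<dots> = (\<Sum>(s', t') \<in> {s'. strong_ll s' s} \<times> {t'. t' \<lless> t}. sharp s' t')"
    by (rule sum.mono_neutral_cong_left) (auto simp: sharp_def split: if_splits)
  also have "\<dots> = star_Z s t"
    by (simp add: star_Z_eq sum.cartesian_product)
  finally show ?thesis .
qed

end

subsection \<open>Substitution homomorphisms\<close>

lemma poly_mapping_monomials:
  "(\<Sum>m\<in>Poly_Mapping.keys p. Poly_Mapping.single m (Poly_Mapping.lookup p m)) = p"
  by (rule poly_mapping_eqI)
    (simp add: lookup_sum lookup_single when_def in_keys_iff)

text \<open>The universal property of a commutative monoid algebra. It serves both the substitution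
  of the \<open>y_var\<close> and the renumbering of variables.\<close>

lemma comm_ring_hom_monomial_extension:
  fixes c :: "'b::comm_ring_1 \<Rightarrow> 'r::comm_ring_1" and w :: "'m::comm_monoid_add \<Rightarrow> 'r"
  assumes c: "comm_ring_hom c" and w: "w 0 = 1" "\<And>a b. w (a + b) = w a * w b"
  shows "comm_ring_hom (\<lambda>p. \<Sum>m\<in>Poly_Mapping.keys p. c (Poly_Mapping.lookup p m) * w m)"
    (is "comm_ring_hom ?h")
proof -
  interpret c: comm_ring_hom c by (rule c)
  \<comment> \<open>Lets polynomials with different supports be summed over a common index
    set.\<close>
  have superset: "?h p = (\<Sum>m\<in>M. c (Poly_Mapping.lookup p m) * w m)"
    if "finite M" "Poly_Mapping.keys p \<subseteq> M" for p M
    by (rule sum.mono_neutral_left) (use that in \<open>auto simp: in_keys_iff\<close>)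
  have single: "?h (Poly_Mapping.single m a) = c a * w m" for m a
    by (subst superset[of "{m}"]) auto
  have add: "?h (p + q) = ?h p + ?h q" for p q
  proof -
    let ?M = "Poly_Mapping.keys p \<union> Poly_Mapping.keys q"
    have "?h (p + q) = (\<Sum>m\<in>?M. c (Poly_Mapping.lookup (p + q) m) * w m)"
      by (rule superset) (simp_all add: keys_add)
    also have "\<dots> = (\<Sum>m\<in>?M. c (Poly_Mapping.lookup p m) * w m) +
        (\<Sum>m\<in>?M. c (Poly_Mapping.lookup q m) * w m)"
      by (simp add: lookup_add c.hom_add distrib_right sum.distrib)
    also have "\<dots> = ?h p + ?h q"
      by (simp add: superset[of ?M p, symmetric] superset[of ?M q, symmetric])
    finally show ?thesis .
  qed
  have sum: "?h (sum f A) = (\<Sum>a\<in>A. ?h (f a))" if "finite A" for f :: "_ \<Rightarrow> ('m \<Rightarrow>\<^sub>0 'b)" and A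
    using that by (induction A rule: finite_induct) (simp_all add: add)
  have mult: "?h (p * q) = ?h p * ?h q" for p q
  proof -
    let ?s = "\<lambda>p m. Poly_Mapping.single m (Poly_Mapping.lookup p m)"
    have "p * q = (\<Sum>m\<in>Poly_Mapping.keys p. ?s p m) * (\<Sum>n\<in>Poly_Mapping.keys q. ?s q n)"
      by (simp only: poly_mapping_monomials)
    also have "\<dots> = (\<Sum>m\<in>Poly_Mapping.keys p. \<Sum>n\<in>Poly_Mapping.keys q.
        Poly_Mapping.single (m + n) (Poly_Mapping.lookup p m * Poly_Mapping.lookup q n))"
      by (simp add: sum_product mult_single)
    finally have "?h (p * q) = (\<Sum>m\<in>Poly_Mapping.keys p. \<Sum>n\<in>Poly_Mapping.keys q.
        c (Poly_Mapping.lookup p m * Poly_Mapping.lookup q n) * w (m + n))"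
      by (simp only: sum finite_keys single)
    then show ?thesis
      by (simp add: sum_product c.hom_mult w mult_ac)
  qed
  have one: "?h 1 = 1" using single[of 0 1] by (simp add: w)
  show ?thesis
    by unfold_locales (simp_all only: add mult one keys_zero sum.empty)
qed

lemma comm_ring_hom_single_zero: "comm_ring_hom (Poly_Mapping.single (0 :: 'm::comm_monoid_add) :: 'b::comm_ring_1 \<Rightarrow> _)"
  by unfold_locales (simp_all add: mult_single single_add)

lemma comm_ring_hom_const: "comm_ring_hom const"
  using comm_ring_hom_single_zero unfolding const_def[abs_def] .

lemma comm_ring_hom_subst_vars: "comm_ring_hom (subst_vars (y :: 'a::finite \<Rightarrow> 'a spoly))"
proof -
  let ?w = "\<lambda>m. \<Prod>s\<in>Poly_Mapping.keys m. y s ^ Poly_Mapping.lookup m s"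
  have w: "?w m = (\<Prod>s\<in>UNIV. y s ^ Poly_Mapping.lookup m s)" for m
    by (rule prod.mono_neutral_left) (auto simp: in_keys_iff)
  have "comm_ring_hom (\<lambda>p. \<Sum>m\<in>Poly_Mapping.keys p. const (Poly_Mapping.lookup p m) * ?w m)"
    by (rule comm_ring_hom_monomial_extension[OF comm_ring_hom_const]; unfold w)
      (simp_all add: lookup_add power_add prod.distrib)
  then show ?thesis by (simp add: subst_vars_def[abs_def])
qed

lemma subst_vars_const [simp]: "subst_vars y (const c) = const c"
  by (cases "c = 0") (simp_all add: subst_vars_def const_def)

lemma subst_vars_var [simp]: "subst_vars y (var s) = y s"
  by (simp add: subst_vars_def var_def const_def)

text \<open>\<open>Poly_Mapping\<close> proves absence of zero divisors only for linearly ordered exponents, and the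
  exponents of \<open>'a spoly\<close> are not ordered. Numbering the variables makes that result available.\<close>

lemma ex_embedding_into_numbered_variables:
  "\<exists>h :: 'a::finite spoly \<Rightarrow> nat spoly. comm_ring_hom h \<and> inj h"
proof -
  obtain g :: "'a \<Rightarrow> nat" where g: "inj g"
    using finite_imp_inj_to_nat_seg[OF finite_UNIV] by auto
  define i :: "('a \<Rightarrow>\<^sub>0 nat) \<Rightarrow> (nat \<Rightarrow>\<^sub>0 nat)"
    where "i m = (\<Sum>s\<in>UNIV. Poly_Mapping.single (g s) (Poly_Mapping.lookup m s))" for m
  have lookup_i: "Poly_Mapping.lookup (i m) (g s) = Poly_Mapping.lookup m s" for m s
    using g by (simp add: i_def lookup_sum lookup_single when_def inj_eq)
  have inj_i: "i m = i m' \<longleftrightarrow> m = m'" for m m'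
    by (metis lookup_i poly_mapping_eqI)
  define h :: "'a spoly \<Rightarrow> nat spoly"
    where "h p = (\<Sum>m\<in>Poly_Mapping.keys p. Poly_Mapping.single 0 (Poly_Mapping.lookup p m) *
      Poly_Mapping.single (i m) 1)" for p
  have "comm_ring_hom h"
    unfolding h_def
    by (rule comm_ring_hom_monomial_extension[OF comm_ring_hom_single_zero])
      (simp_all add: i_def lookup_add single_add sum.distrib mult_single)
  moreover have "Poly_Mapping.lookup (h p) (i m) = Poly_Mapping.lookup p m" for p m
    by (simp add: h_def mult_single lookup_sum lookup_single when_def inj_i in_keys_iff)
  then have "inj h" by (metis injI poly_mapping_eqI)
  ultimately show ?thesis by blast
qed

subsection \<open>Determinants indexed by lists\<close>

text \<open>The formula of \<open>submatrix_det\<close> over any commutative ring, because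
  determinants are also taken after mapping the entries to \<open>nat spoly\<close>.\<close>

definition list_det :: "('s \<Rightarrow> 't \<Rightarrow> 'r::comm_ring_1) \<Rightarrow> 's list \<Rightarrow> 't list \<Rightarrow> 'r" where
  "list_det M rs cs = (if length rs = length cs
     then det (mat (length rs) (length cs) (\<lambda>(i, j). M (rs ! i) (cs ! j))) else 0)"

lemma submatrix_det_eq_list_det: "submatrix_det = list_det"
  by (intro ext) (simp add: submatrix_det_def list_det_def)

lemma list_det_cong:
  assumes "\<And>s t. s \<in> set rs \<Longrightarrow> t \<in> set cs \<Longrightarrow> M s t = N s t"
  shows "list_det M rs cs = list_det N rs cs"
proof -
  have "mat (length rs) (length cs) (\<lambda>(i, j). M (rs ! i) (cs ! j)) =
      mat (length rs) (length cs) (\<lambda>(i, j). N (rs ! i) (cs ! j))"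
    by (rule eq_matI) (simp_all add: assms)
  then show ?thesis unfolding list_det_def by argo
qed

lemma list_det_expand:
  assumes "length rs = length cs"
  shows "list_det M rs cs =
    (\<Sum>p | p permutes {0..<length rs}. signof p * (\<Prod>i = 0..<length rs. M (rs ! i) (cs ! p i)))"
proof -
  have "p i < length rs" if "p permutes {0..<length rs}" "i < length rs" for p i
    using permutes_in_image[OF that(1), of i] that(2) by simp
  then show ?thesis
    using assms by (auto simp: list_det_def det_def intro!: sum.cong prod.cong)
qed

lemma (in comm_ring_hom) hom_list_det: "hom (list_det M rs cs) = list_det (\<lambda>s t. hom (M s t)) rs cs"
proof -
  have "map_mat hom (mat m n (\<lambda>(i, j). M (rs ! i) (cs ! j))) =
      mat m n (\<lambda>(i, j). hom (M (rs ! i) (cs ! j)))" for m n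
    by (rule eq_matI) simp_all
  then show ?thesis by (simp add: list_det_def flip: hom_det)
qed

lemma list_det_transpose: "list_det (\<lambda>t s. M s t) cs rs = list_det M rs cs"
proof (cases "length rs = length cs")
  case True
  let ?A = "mat (length rs) (length rs) (\<lambda>(i, j). M (rs ! i) (cs ! j))"
  have "transpose_mat ?A = mat (length rs) (length rs) (\<lambda>(i, j). M (rs ! j) (cs ! i))"
    by (rule eq_matI) simp_all
  then show ?thesis
    using True det_transpose[of ?A "length rs"] by (simp add: list_det_def)
qed (simp add: list_det_def)

lemma list_det_mult:
  assumes "length rs = length us" and "distinct us"
  shows "list_det (\<lambda>s t. \<Sum>u\<in>set us. A s u * B u t) rs cs = list_det A rs us * list_det B us cs"
proof (cases "length us = length cs")
  case True
  let ?n = "length us"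
  let ?A = "mat ?n ?n (\<lambda>(i, j). A (rs ! i) (us ! j))"
  let ?B = "mat ?n ?n (\<lambda>(i, j). B (us ! i) (cs ! j))"
  have sum: "(\<Sum>u\<in>set us. f u) = (\<Sum>k = 0..<?n. f (us ! k))" for f :: "_ \<Rightarrow> 'c"
    using assms(2) by (simp add: sum.distinct_set_conv_list sum_list_sum_nth)
  have "mat ?n ?n (\<lambda>(i, j). \<Sum>u\<in>set us. A (rs ! i) u * B u (cs ! j)) = ?A * ?B"
    by (rule eq_matI) (simp_all add: scalar_prod_def sum)
  then show ?thesis
    using True assms(1) det_mult[of ?A ?n ?B] by (simp add: list_det_def)
\<comment> \<open>If \<open>us\<close> and \<open>cs\<close> differ in length, both sides take the
  default value 0.\<close>
qed (use assms in \<open>simp add: list_det_def\<close>)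

text \<open>If a permutation \<open>p\<close> contributes, then \<open>r\<close> never decreases
  from position \<open>i\<close> to \<open>p i\<close>, and it grows where \<open>p\<close> moves
  \<open>i\<close>. Summing over all positions contradicts the invariance of the sum under
  \<open>p\<close>.\<close>

lemma list_det_unitriangular:
  fixes M :: "'s \<Rightarrow> 's \<Rightarrow> 'r::comm_ring_1" and r :: "'s \<Rightarrow> nat"
  assumes "distinct xs" and diag: "\<And>s. s \<in> set xs \<Longrightarrow> M s s = 1"
    and tri: "\<And>s t. s \<in> set xs \<Longrightarrow> t \<in> set xs \<Longrightarrow> s \<noteq> t \<Longrightarrow> M s t \<noteq> 0 \<Longrightarrow> r s < r t"
  shows "list_det M xs xs = 1"
proof -
  let ?n = "length xs"
  let ?term = "\<lambda>p. signof p * (\<Prod>i = 0..<?n. M (xs ! i) (xs ! p i))"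
  have "?term p = 0" if p: "p permutes {0..<?n}" "p \<noteq> id" for p
  proof (rule ccontr)
    assume nz: "?term p \<noteq> 0"
    have p_lt: "p i < ?n" if "i < ?n" for i
      using permutes_in_image[OF p(1), of i] that by simp
    have M_nz: "M (xs ! i) (xs ! p i) \<noteq> 0" if "i < ?n" for i
    proof
      assume "M (xs ! i) (xs ! p i) = 0"
      then have "(\<Prod>i = 0..<?n. M (xs ! i) (xs ! p i)) = 0"
        by (subst prod.remove[of _ i]) (use that in auto)
      with nz show False by simp
    qed
    have le: "r (xs ! i) \<le> r (xs ! p i)" and lt: "p i \<noteq> i \<Longrightarrow> r (xs ! i) < r (xs ! p i)"
      if "i < ?n" for i
    proof -
      show "p i \<noteq> i \<Longrightarrow> r (xs ! i) < r (xs ! p i)"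
        using tri[of "xs ! i" "xs ! p i"] M_nz[OF that] p_lt[OF that] that \<open>distinct xs\<close>
        by (auto simp: nth_eq_iff_index_eq)
      then show "r (xs ! i) \<le> r (xs ! p i)" by (cases "p i = i") auto
    qed
    obtain k where k: "p k \<noteq> k" using p(2) by (auto simp: fun_eq_iff)
    then have "k < ?n" using p(1) by (auto simp: permutes_def)
    have "(\<Sum>i\<in>{0..<?n}. r (xs ! i)) < (\<Sum>i\<in>{0..<?n}. r (xs ! p i))"
      by (rule sum_strict_mono_ex1) (use le lt[OF \<open>k < ?n\<close> k] \<open>k < ?n\<close> in \<open>auto intro!: bexI[of _ k]\<close>)
    also have "\<dots> = (\<Sum>i\<in>{0..<?n}. r (xs ! i))"
      using sum.permute[OF p(1), of "\<lambda>i. r (xs ! i)"] by (simp add: o_def)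
    finally show False by simp
  qed
  then have "(\<Sum>p | p permutes {0..<?n}. ?term p) = (\<Sum>p\<in>{id}. ?term p)"
    by (intro sum.mono_neutral_right) (auto simp: finite_permutations permutes_id)
  also have "\<dots> = 1" by (simp add: diag)
  finally show ?thesis by (simp add: list_det_expand)
qed

text \<open>The two row lists differ by a permutation, whose sign is the factor.\<close>

lemma list_det_reorder_rows:
  fixes M :: "'s \<Rightarrow> 't \<Rightarrow> 'r::comm_ring_1"
  assumes "distinct rs" "distinct rs'" "set rs = set rs'"
  shows "list_det M rs cs = list_det M rs' cs \<or> list_det M rs cs = - list_det M rs' cs"
proof (cases "length rs' = length cs")
  case True
  let ?n = "length cs"
  have "mset rs = mset rs'" using assms by (simp add: set_eq_iff_mset_eq_distinct)
  then obtain p where p: "p permutes {..<length rs'}" "permute_list p rs' = rs"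
    by (rule mset_eq_permutation)
  have len: "length rs = ?n" using p True by auto
  let ?A = "mat ?n ?n (\<lambda>(i, j). M (rs' ! i) (cs ! j))"
  have p': "p permutes {0..<?n}" using p True by (simp add: atLeast0LessThan)
  have nth: "rs ! i = rs' ! p i" "p i < ?n" if "i < ?n" for i
    using p that True permute_list_nth[OF p(1), of i] permutes_in_image[OF p', of i] by auto
  have "mat ?n ?n (\<lambda>(i, j). ?A $$ (p i, j)) = mat ?n ?n (\<lambda>(i, j). M (rs ! i) (cs ! j))"
    by (rule eq_matI) (simp_all add: nth)
  then have "list_det M rs cs = signof p * list_det M rs' cs"
    using det_permute_rows[of ?A ?n p] p' True len by (simp add: list_det_def)
  then show ?thesis by (cases p rule: sign_cases) simp_all
next
  case False
  have "length rs = length rs'" using assms by (metis distinct_card)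
  with False show ?thesis by (simp add: list_det_def)
qed

lemma list_det_reorder:
  fixes M :: "'s \<Rightarrow> 't \<Rightarrow> 'r::comm_ring_1"
  assumes "distinct rs" "distinct rs'" "set rs = set rs'" "distinct cs" "distinct cs'" "set cs = set cs'"
  shows "list_det M rs cs = list_det M rs' cs' \<or> list_det M rs cs = - list_det M rs' cs'"
  using list_det_reorder_rows[OF assms(1-3), of M cs]
    list_det_reorder_rows[OF assms(4-6), of "\<lambda>t s. M s t" rs',
      unfolded list_det_transpose[of M cs rs'] list_det_transpose[of M cs' rs']]
  by auto

text \<open>The easy half of the Frobenius-Koenig theorem: by the pigeonhole principle no
  permutation places all rows of \<open>S\<close> in columns of \<open>T\<close>, so every term of
  the expansion has a zero factor.\<close>

lemma list_det_eq_0: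
  assumes "distinct rs" "S \<subseteq> set rs" "finite T" "card T < card S"
    and zero: "\<And>s t. s \<in> S \<Longrightarrow> t \<in> set cs \<Longrightarrow> t \<notin> T \<Longrightarrow> M s t = 0"
    and "distinct cs"
  shows "list_det M rs cs = 0"
proof (cases "length rs = length cs")
  case True
  let ?n = "length rs"
  have "(\<Prod>i = 0..<?n. M (rs ! i) (cs ! p i)) = 0" if p: "p permutes {0..<?n}" for p
  proof -
    let ?I = "{i \<in> {0..<?n}. rs ! i \<in> S}"
    have p_lt: "p i < ?n" if "i < ?n" for i
      using permutes_in_image[OF p, of i] that by simp
    have "(\<lambda>i. rs ! i) ` ?I = S"
      using \<open>S \<subseteq> set rs\<close> by (auto simp: in_set_conv_nth image_iff) (metis in_set_conv_nth subsetD)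
    then have "card S \<le> card ?I" using card_image_le[of ?I "\<lambda>i. rs ! i"] by simp
    have "inj_on (\<lambda>i. cs ! p i) ?I"
    proof (rule inj_onI)
      fix i j assume "i \<in> ?I" "j \<in> ?I" "cs ! p i = cs ! p j"
      then have "p i = p j" using \<open>distinct cs\<close> p_lt True by (simp add: nth_eq_iff_index_eq)
      then show "i = j" using permutes_inj[OF p] by (simp add: inj_eq)
    qed
    then have "\<not> (\<lambda>i. cs ! p i) ` ?I \<subseteq> T"
      using card_inj_on_le[of "\<lambda>i. cs ! p i" ?I T] \<open>finite T\<close> \<open>card T < card S\<close> \<open>card S \<le> card ?I\<close>
      by linarith
    then obtain i where i: "i \<in> ?I" "cs ! p i \<notin> T" by blast
    then have "M (rs ! i) (cs ! p i) = 0" using p_lt True by (intro zero) auto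
    then show ?thesis by (subst prod.remove[of _ i]) (use i in auto)
  qed
  then show ?thesis by (simp add: list_det_expand True)
qed (simp add: list_det_def)

section \<open>Block triangular and block diagonal determinants\<close>

lemma list_det_append:
  fixes M :: "'s \<Rightarrow> 't \<Rightarrow> 'r::idom"
  assumes len: "length rs1 = length cs1" "length rs2 = length cs2"
    and zero: "\<And>s t. s \<in> set rs1 \<Longrightarrow> t \<in> set cs2 \<Longrightarrow> M s t = 0"
  shows "list_det M (rs1 @ rs2) (cs1 @ cs2) = list_det M rs1 cs1 * list_det M rs2 cs2"
proof -
  let ?m = "length rs1" and ?n = "length rs2"
  let ?A = "mat ?m ?m (\<lambda>(i, j). M (rs1 ! i) (cs1 ! j))"
  let ?C = "mat ?n ?m (\<lambda>(i, j). M (rs2 ! i) (cs1 ! j))"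
  let ?D = "mat ?n ?n (\<lambda>(i, j). M (rs2 ! i) (cs2 ! j))"
  have "mat (?m + ?n) (?m + ?n) (\<lambda>(i, j). M ((rs1 @ rs2) ! i) ((cs1 @ cs2) ! j)) =
      four_block_mat ?A (0\<^sub>m ?m ?n) ?C ?D"
    by (rule eq_matI) (auto simp: nth_append len zero)
  then show ?thesis
    using det_four_block_mat_upper_right_zero[of ?A ?m "0\<^sub>m ?m ?n" ?n ?C ?D] len
    by (simp add: list_det_def)
qed

lemma list_det_concat:
  fixes M :: "'s \<Rightarrow> 't \<Rightarrow> 'r::idom" and rows :: "'e \<Rightarrow> 's list" and cols :: "'e \<Rightarrow> 't list"
  assumes "distinct es" and "\<And>e. e \<in> set es \<Longrightarrow> length (rows e) = length (cols e)"
    and "\<And>e e' s t. e \<in> set es \<Longrightarrow> e' \<in> set es \<Longrightarrow> e \<noteq> e' \<Longrightarrow> s \<in> set (rows e) \<Longrightarrow>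
      t \<in> set (cols e') \<Longrightarrow> M s t = 0"
  shows "list_det M (concat (map rows es)) (concat (map cols es)) =
    (\<Prod>e\<in>set es. list_det M (rows e) (cols e))"
  using assms
proof (induction es)
  case Nil
  show ?case by (simp add: list_det_def)
next
  case (Cons e es)
  have len: "length (concat (map rows es)) = length (concat (map cols es))"
    using Cons.prems(2) by (simp add: length_concat comp_def cong: map_cong)
  have "list_det M (rows e @ concat (map rows es)) (cols e @ concat (map cols es)) =
      list_det M (rows e) (cols e) * list_det M (concat (map rows es)) (concat (map cols es))"
  proof (rule list_det_append[OF _ len])
    show "length (rows e) = length (cols e)" using Cons.prems(2) by simp
    fix s t assume "s \<in> set (rows e)" "t \<in> set (concat (map cols es))"
    then obtain e' where "e' \<in> set es" "t \<in> set (cols e')" by auto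
    then show "M s t = 0" using Cons.prems(1) \<open>s \<in> set (rows e)\<close>
      by (intro Cons.prems(3)[of e e']) auto
  qed
  moreover have "list_det M (concat (map rows es)) (concat (map cols es)) =
      (\<Prod>e\<in>set es. list_det M (rows e) (cols e))"
    using Cons.prems(1) by (intro Cons.IH Cons.prems) auto
  ultimately show ?case using Cons.prems(1) by simp
qed

text \<open>Grouping rows and columns by label costs only a sign. If some block is not square, its
  factor is 0 by convention, and a label with more rows than columns makes the left side vanish
  too.\<close>

lemma list_det_block_diagonal:
  fixes M :: "'s \<Rightarrow> 't \<Rightarrow> 'r::idom" and f :: "'s \<Rightarrow> 'e" and g :: "'t \<Rightarrow> 'e"
    and rows :: "'e \<Rightarrow> 's list" and cols :: "'e \<Rightarrow> 't list"
  assumes "finite E" and rs: "distinct rs" "f ` set rs \<subseteq> E" and cs: "distinct cs" "g ` set cs \<subseteq> E"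
    and len: "length rs = length cs"
    and rows: "\<And>e. e \<in> E \<Longrightarrow> distinct (rows e)" "\<And>e. e \<in> E \<Longrightarrow> set (rows e) = {s \<in> set rs. f s = e}"
    and cols: "\<And>e. e \<in> E \<Longrightarrow> distinct (cols e)" "\<And>e. e \<in> E \<Longrightarrow> set (cols e) = {t \<in> set cs. g t = e}"
    and M: "\<And>s t. M s t \<noteq> 0 \<Longrightarrow> f s = g t"
  defines "P \<equiv> \<Prod>e\<in>E. list_det M (rows e) (cols e)"
  shows "list_det M rs cs = P \<or> list_det M rs cs = - P"
proof (cases "\<forall>e\<in>E. length (rows e) = length (cols e)")
  case True
  obtain es where es: "set es = E" "distinct es" using finite_distinct_list[OF \<open>finite E\<close>] by blast
  have conc: "distinct (concat (map h es))"
    if "\<And>e. e \<in> E \<Longrightarrow> distinct (h e)" "\<And>e. e \<in> E \<Longrightarrow> set (h e) = {s \<in> A. k s = e}"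
    for h :: "'e \<Rightarrow> 'z list" and A k
    using es(2) that unfolding es(1)[symmetric]
    by (induction es) auto
  have "list_det M rs cs = list_det M (concat (map rows es)) (concat (map cols es)) \<or>
      list_det M rs cs = - list_det M (concat (map rows es)) (concat (map cols es))"
    using rs cs conc[of rows, OF rows] conc[of cols, OF cols]
    by (intro list_det_reorder) (auto simp: es rows cols)
  moreover have "list_det M (concat (map rows es)) (concat (map cols es)) = P"
    unfolding P_def es(1)[symmetric]
  proof (rule list_det_concat[OF es(2)])
    show "length (rows e) = length (cols e)" if "e \<in> set es" for e using True that es by simp
    show "M s t = 0" if "e \<in> set es" "e' \<in> set es" "e \<noteq> e'" "s \<in> set (rows e)" "t \<in> set (cols e')"
      for e e' s t
      using that M[of s t] rows(2)[of e] cols(2)[of e'] es by auto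
  qed
  ultimately show ?thesis by simp
next
  case False
  then obtain e0 where e0: "e0 \<in> E" "length (rows e0) \<noteq> length (cols e0)" by blast
  have fibres: "(\<Sum>e\<in>E. length (h e)) = length zs"
    if "distinct zs" "k ` set zs \<subseteq> E" "\<And>e. e \<in> E \<Longrightarrow> distinct (h e)"
      "\<And>e. e \<in> E \<Longrightarrow> set (h e) = {z \<in> set zs. k z = e}"
    for h :: "'e \<Rightarrow> 'z list" and k zs
  proof -
    have "length zs = (\<Sum>z\<in>set zs. 1)" using that(1) by (simp add: distinct_card)
    also have "\<dots> = (\<Sum>e\<in>E. \<Sum>z\<in>{z \<in> set zs. k z = e}. 1)"
      by (rule sum.group[symmetric]) (use that(2) \<open>finite E\<close> in auto)
    also have "\<dots> = (\<Sum>e\<in>E. length (h e))"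
      by (rule sum.cong) (use that(3,4) in \<open>auto simp: distinct_card[symmetric]\<close>)
    finally show ?thesis by simp
  qed
  \<comment> \<open>Block \<open>e0\<close> may have too many columns instead; as the totals agree,
    another block then has too many rows.\<close>
  have "\<exists>e\<in>E. length (cols e) < length (rows e)"
  proof (rule ccontr)
    assume "\<not> ?thesis"
    then have "(\<Sum>e\<in>E. length (rows e)) < (\<Sum>e\<in>E. length (cols e))"
      by (intro sum_strict_mono_ex1) (use \<open>finite E\<close> e0 in \<open>auto simp: not_less intro!: bexI[of _ e0]\<close>)
    then show False using fibres[OF rs rows] fibres[OF cs cols] len by simp
  qed
  then obtain e where e: "e \<in> E" "length (cols e) < length (rows e)" by blast
  have "list_det M rs cs = 0"
  proof (rule list_det_eq_0[where S = "set (rows e)" and T = "set (cols e)"])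
    show "card (set (cols e)) < card (set (rows e))" using e rows(1) cols(1) by (simp add: distinct_card)
    show "M s t = 0" if "s \<in> set (rows e)" "t \<in> set cs" "t \<notin> set (cols e)" for s t
      using that M[of s t] rows(2)[OF e(1)] cols(2)[OF e(1)] by auto
  qed (use rs cs rows(2)[OF e(1)] in auto)
  moreover have "P = 0"
    unfolding P_def using e(1) e0 \<open>finite E\<close> by (intro prod_zero) (auto simp: list_det_def)
  ultimately show ?thesis by simp
qed

subsection \<open>The Moebius function\<close>

text \<open>The defining equation is solved for its top term \<open>m s t\<close>. The recursion is
  well-founded because principal lower sets grow strictly along the order.\<close>

lemma ex_moebius:
  fixes le :: "'a::finite \<Rightarrow> 'a \<Rightarrow> bool"
  assumes refl: "\<And>s. le s s" and antisym: "\<And>s t. le s t \<Longrightarrow> le t s \<Longrightarrow> s = t"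
    and trans: "\<And>r s t. le r s \<Longrightarrow> le s t \<Longrightarrow> le r t"
  shows "\<exists>m :: 'a \<Rightarrow> 'a \<Rightarrow> int. \<forall>s t. (\<not> le s t \<longrightarrow> m s t = 0) \<and>
    (le s t \<longrightarrow> (\<Sum>u | le s u \<and> le u t. m s u) = (if s = t then 1 else 0))"
proof -
  define R where "R = {(u, t). le u t \<and> u \<noteq> t}"
  have "R \<subseteq> measure (\<lambda>t. card {v. le v t})"
  proof clarify
    fix u t assume "(u, t) \<in> R"
    then have "le u t" "\<not> le t u" using antisym by (auto simp: R_def)
    then have "{v. le v u} \<subset> {v. le v t}" using refl[of t] trans by blast
    then show "(u, t) \<in> measure (\<lambda>t. card {v. le v t})" by (simp add: psubset_card_mono)
  qed
  then have "wf R" by (rule wf_subset[OF wf_measure])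
  define F :: "'a \<Rightarrow> ('a \<Rightarrow> int) \<Rightarrow> 'a \<Rightarrow> int" where
    "F s g t = (if le s t then (if s = t then 1 else 0) - (\<Sum>u | le s u \<and> le u t \<and> u \<noteq> t. g u) else 0)"
    for s g t
  define m where "m s = wfrec R (F s)" for s
  have m: "m s t = (if le s t
      then (if s = t then 1 else 0) - (\<Sum>u | le s u \<and> le u t \<and> u \<noteq> t. m s u) else 0)" for s t
  proof -
    have "m s t = F s (cut (m s) R t) t" unfolding m_def by (rule wfrec[OF \<open>wf R\<close>])
    also have "\<dots> = F s (m s) t"
      by (auto simp: F_def R_def cut_def intro!: sum.cong)
    finally show ?thesis by (simp add: F_def)
  qed
  have "(\<Sum>u | le s u \<and> le u t. m s u) = (if s = t then 1 else 0)" if "le s t" for s t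
  proof -
    have "{u. le s u \<and> le u t} = insert t {u. le s u \<and> le u t \<and> u \<noteq> t}"
      using that refl by auto
    then have "(\<Sum>u | le s u \<and> le u t. m s u) =
        m s t + (\<Sum>u | le s u \<and> le u t \<and> u \<noteq> t. m s u)" by simp
    then show ?thesis using m[of s t] that by simp
  qed
  moreover have "m s t = 0" if "\<not> le s t" for s t using m[of s t] that by simp
  ultimately show ?thesis by blast
qed

section \<open>Inverting the zeta function of \<open>\<lless>\<close> and the map
  \<open>Z\<close>\<close>

context smooth_semigroup
begin

text \<open>The equations defining \<open>mu\<close> describe a left inverse of the zeta function. A
  left and a right inverse coincide, so the solution is unique, which justifies the
  \<open>THE\<close>, and it is a two-sided inverse.\<close>

lemma mu_inverse:
  fixes s t :: 'a
  shows "\<not> s \<lless> t \<Longrightarrow> mu s t = 0"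
    and "(\<Sum>u\<in>UNIV. mu s u * of_bool (u \<lless> t)) = of_bool (s = t)"
    and "(\<Sum>u\<in>UNIV. of_bool (s \<lless> u) * mu u t) = of_bool (s = t)"
proof -
  let ?P = "\<lambda>m :: 'a \<Rightarrow> 'a \<Rightarrow> int. \<forall>s t. (\<not> s \<lless> t \<longrightarrow> m s t = 0) \<and>
     (s \<lless> t \<longrightarrow> (\<Sum>u | s \<lless> u \<and> u \<lless> t. m s u) = (if s = t then 1 else 0))"
  have left: "(\<Sum>u\<in>UNIV. m s u * of_bool (u \<lless> t)) = of_bool (s = t)" if "?P m" for m s t
  proof -
    have "(\<Sum>u\<in>UNIV. m s u * of_bool (u \<lless> t)) = (\<Sum>u | s \<lless> u \<and> u \<lless> t. m s u)"
      by (rule sum.mono_neutral_cong_right) (use that in auto)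
    also have "\<dots> = of_bool (s = t)"
    proof (cases "s \<lless> t")
      case True
      then show ?thesis using that by simp
    next
      case False
      then have empty: "{u. s \<lless> u \<and> u \<lless> t} = {}" and "s \<noteq> t" using ll_trans ll_refl by blast+
      then show ?thesis unfolding empty by simp
    qed
    finally show ?thesis .
  qed
  obtain m where m: "?P m"
    using ex_moebius[of "(\<lless>) :: 'a \<Rightarrow> 'a \<Rightarrow> bool"] ll_refl ll_antisym ll_trans by blast
  \<comment> \<open>A Moebius function of the opposite order; with its arguments swapped it is a
    right inverse of zeta.\<close>
  obtain n where n: "\<And>s t :: 'a. \<not> t \<lless> s \<Longrightarrow> n s t = 0"
    "\<And>s t :: 'a. t \<lless> s \<Longrightarrow> (\<Sum>u | u \<lless> s \<and> t \<lless> u. n s u) = (if s = t then 1 else (0::int))"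
    using ex_moebius[of "\<lambda>s t :: 'a. t \<lless> s"] ll_refl ll_antisym ll_trans by blast
  have right: "(\<Sum>u\<in>UNIV. of_bool (s \<lless> u) * n t u) = of_bool (s = t)" for s t
  proof -
    have "(\<Sum>u\<in>UNIV. of_bool (s \<lless> u) * n t u) = (\<Sum>u | u \<lless> t \<and> s \<lless> u. n t u)"
      by (rule sum.mono_neutral_cong_right) (use n(1) in auto)
    also have "\<dots> = of_bool (s = t)"
    proof (cases "s \<lless> t")
      case True
      then show ?thesis using n(2)[of s t] by auto
    next
      case False
      then have empty: "{u. u \<lless> t \<and> s \<lless> u} = {}" and "s \<noteq> t" using ll_trans ll_refl by blast+
      then show ?thesis unfolding empty by simp
    qed
    finally show ?thesis .
  qed
  have unique: "m s t = n t s" if "?P m" for m s t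
  proof -
    have "m s t = (\<Sum>u\<in>UNIV. m s u * of_bool (u = t))" by simp
    also have "\<dots> = (\<Sum>u\<in>UNIV. \<Sum>v\<in>UNIV. m s u * (of_bool (u \<lless> v) * n t v))"
      by (simp only: right[symmetric] sum_distrib_left)
    also have "\<dots> = (\<Sum>v\<in>UNIV. \<Sum>u\<in>UNIV. m s u * (of_bool (u \<lless> v) * n t v))"
      by (rule sum.swap)
    also have "\<dots> = (\<Sum>v\<in>UNIV. (\<Sum>u\<in>UNIV. m s u * of_bool (u \<lless> v)) * n t v)"
      by (simp only: sum_distrib_right mult.assoc)
    also have "\<dots> = n t s" by (simp add: left[OF that])
    finally show ?thesis .
  qed
  have "m' = m" if "?P m'" for m'
    using unique[OF that] unique[OF m] by (intro ext) simp
  then have mu: "mu = m" unfolding mu_def using m by (intro the_equality) blast+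
  show "\<not> s \<lless> t \<Longrightarrow> mu s t = 0" using m mu by blast
  show "(\<Sum>u\<in>UNIV. mu s u * of_bool (u \<lless> t)) = of_bool (s = t)" unfolding mu by (rule left[OF m])
  show "(\<Sum>u\<in>UNIV. of_bool (s \<lless> u) * mu u t) = of_bool (s = t)"
    unfolding mu unique[OF m] by (rule right)
qed

lemma mu_diag: "mu s s = (1 :: int)" for s :: 'a
proof -
  have "(\<Sum>u\<in>UNIV. mu s u * of_bool (u \<lless> s)) = (\<Sum>u\<in>{s}. mu s u * of_bool (u \<lless> s))"
    by (rule sum.mono_neutral_right) (use mu_inverse(1) ll_antisym in auto)
  then show ?thesis using mu_inverse(2)[of s s] by (simp add: ll_refl)
qed

lemma mu_inverse_of_int:
  fixes s t :: 'a
  shows "(\<Sum>u\<in>UNIV. of_int (mu s u) * of_bool (u \<lless> t)) = (of_bool (s = t) :: 'r::ring_1)"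
    and "(\<Sum>u\<in>UNIV. of_bool (s \<lless> u) * of_int (mu u t)) = (of_bool (s = t) :: 'r::ring_1)"
proof -
  have eq: "(of_int (of_bool P) :: 'r) = of_bool P" for P by simp
  show "(\<Sum>u\<in>UNIV. of_int (mu s u) * of_bool (u \<lless> t)) = (of_bool (s = t) :: 'r)"
    using arg_cong[OF mu_inverse(2)[of s t], of "of_int :: int \<Rightarrow> 'r"] by (simp only: of_int_sum of_int_mult eq)
  show "(\<Sum>u\<in>UNIV. of_bool (s \<lless> u) * of_int (mu u t)) = (of_bool (s = t) :: 'r)"
    using arg_cong[OF mu_inverse(3)[of s t], of "of_int :: int \<Rightarrow> 'r"] by (simp only: of_int_sum of_int_mult eq)
qed

text \<open>Moebius inversion of the definition of \<open>y_var\<close>.\<close>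

lemma sum_y_var:
  fixes w :: 'a
  shows "(\<Sum>u | u \<lless> w. y_var u) = var w"
proof -
  have y: "y_var u = (\<Sum>t\<in>UNIV. of_int (mu t u) * var t)" for u :: 'a
    unfolding y_var_def
    by (rule sum.mono_neutral_left) (auto simp: mu_inverse(1))
  have "(\<Sum>u | u \<lless> w. y_var u) = (\<Sum>u\<in>UNIV. y_var u * of_bool (u \<lless> w))"
    by (rule sum.mono_neutral_cong_left) auto
  also have "\<dots> = (\<Sum>u\<in>UNIV. \<Sum>t\<in>UNIV. (of_int (mu t u) * of_bool (u \<lless> w)) * var t)"
    by (simp only: y sum_distrib_left sum_distrib_right mult_ac)
  also have "\<dots> = (\<Sum>t\<in>UNIV. \<Sum>u\<in>UNIV. (of_int (mu t u) * of_bool (u \<lless> w)) * var t)"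
    by (rule sum.swap)
  also have "\<dots> = (\<Sum>t\<in>UNIV. of_bool (t = w) * var t)"
    by (simp only: sum_distrib_right[symmetric] mu_inverse_of_int)
  also have "\<dots> = var w" by simp
  finally show ?thesis .
qed

lemma lookup_Z: "Poly_Mapping.lookup (Z f) u = (\<Sum>s\<in>UNIV. Poly_Mapping.lookup f s * of_bool (u \<lless> s))"
  for u :: 'a
  by (simp add: Z_def lin_ext_def lookup_sum lookup_basis of_bool_def)

text \<open>The matrix of \<open>Z\<close> is the zeta function of \<open>\<lless>\<close>. The left
  inverse \<open>mu\<close> makes \<open>Z\<close> injective; as a right inverse it supplies the
  preimage.\<close>

lemma inv_Z_basis:
  "inv_into UNIV Z (basis s) = (\<Sum>a\<in>UNIV. scale (of_int (mu a s)) (basis a))" for s :: 'a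
proof (rule inv_f_eq)
  show "inj (Z :: 'a salg \<Rightarrow> _)"
  proof (rule injI)
    fix f g :: "'a salg" assume Z: "Z f = Z g"
    have recover: "Poly_Mapping.lookup f t = (\<Sum>u\<in>UNIV. of_int (mu t u) * Poly_Mapping.lookup (Z f) u)"
      for f :: "'a salg" and t
    proof -
      have "(\<Sum>u\<in>UNIV. of_int (mu t u) * Poly_Mapping.lookup (Z f) u) =
          (\<Sum>u\<in>UNIV. \<Sum>s\<in>UNIV. (of_int (mu t u) * of_bool (u \<lless> s)) * Poly_Mapping.lookup f s)"
        by (simp only: lookup_Z sum_distrib_left mult_ac)
      also have "\<dots> = (\<Sum>s\<in>UNIV. \<Sum>u\<in>UNIV. (of_int (mu t u) * of_bool (u \<lless> s)) * Poly_Mapping.lookup f s)"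
        by (rule sum.swap)
      also have "\<dots> = Poly_Mapping.lookup f t"
        by (simp only: sum_distrib_right[symmetric] mu_inverse_of_int) simp
      finally show ?thesis by simp
    qed
    show "f = g" by (rule poly_mapping_eqI) (simp only: recover[of f] recover[of g] Z)
  qed
  show "Z (\<Sum>a\<in>UNIV. scale (of_int (mu a s)) (basis a)) = basis s"
  proof (rule poly_mapping_eqI)
    fix u
    have "Poly_Mapping.lookup (Z (\<Sum>a\<in>UNIV. scale (of_int (mu a s)) (basis a))) u =
        (\<Sum>a\<in>UNIV. of_bool (u \<lless> a) * of_int (mu a s))"
      by (simp add: lookup_Z lookup_sum lookup_basis mult.commute if_distrib[of "\<lambda>x. _ * x"] cong: if_cong)
    also have "\<dots> = Poly_Mapping.lookup (basis s) u"
      by (simp only: mu_inverse_of_int) (simp add: lookup_basis)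
    finally show "Poly_Mapping.lookup (Z (\<Sum>a\<in>UNIV. scale (of_int (mu a s)) (basis a))) u =
        Poly_Mapping.lookup (basis s) u" .
  qed
qed

lemma star_mult_basis:
  fixes s t :: 'a
  shows "star_mult (basis s) (basis t) =
    (\<Sum>a\<in>UNIV. \<Sum>b\<in>UNIV. scale (of_int (mu a s) * of_int (mu b t)) (star_Z a b))"
proof -
  have "Poly_Mapping.lookup (\<Sum>a\<in>UNIV. scale (of_int (mu a s)) (basis a)) u = of_int (mu u s)"
    for u s :: 'a
    by (simp add: lookup_sum lookup_basis if_distrib[of "\<lambda>x. _ * x"] cong: if_cong)
  then show ?thesis by (simp add: star_mult_def bilin_ext_def inv_Z_basis)
qed

end

subsection \<open>Block factorisation\<close>

text \<open>Composed with \<open>Z\<close>, this linear map sends \<open>basis s\<close> to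
  \<open>var s\<close>. It turns identities in the semigroup algebra into identities between tables
  of polynomials.\<close>

definition y_eval :: "'a::{finite,semigroup_mult} salg \<Rightarrow> 'a spoly" where
  "y_eval f = (\<Sum>u\<in>UNIV. const (Poly_Mapping.lookup f u) * y_var u)"

definition sharp_table :: "'a::{finite,semigroup_mult} \<Rightarrow> 'a \<Rightarrow> 'a spoly" where
  "sharp_table s t = y_eval (sharp s t)"

interpretation const: comm_ring_hom const
  by (rule comm_ring_hom_const)

lemma of_int_spoly: "const (of_int k) = of_int k"
  by (simp add: const_def)

lemma y_eval_basis: "y_eval (basis s) = y_var s"
  by (simp add: y_eval_def lookup_basis if_distrib[of const] if_distrib[of "\<lambda>x. x * _"] cong: if_cong)

lemma y_eval_0 [simp]: "y_eval 0 = 0"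
  by (simp add: y_eval_def)

lemma y_eval_add: "y_eval (f + g) = y_eval f + y_eval g"
  by (simp add: y_eval_def lookup_add const.hom_add distrib_right sum.distrib)

lemma y_eval_scale: "y_eval (scale c f) = const c * y_eval f"
  by (simp add: y_eval_def const.hom_mult sum_distrib_left mult.assoc)

lemma y_eval_sum: "y_eval (\<Sum>a\<in>A. f a) = (\<Sum>a\<in>A. y_eval (f a))"
  by (induction A rule: infinite_finite_induct) (simp_all add: y_eval_add)

lemma sharp_table_nonzero_imp: "sharp_table s t \<noteq> 0 \<Longrightarrow> sstar s = splus t"
  by (auto simp: sharp_table_def sharp_def split: if_splits)

lemma subst_vars_star_table:
  "subst_vars y_var (star_table s t) = y_eval (star_mult (basis s) (basis t))"
proof -
  interpret subst: comm_ring_hom "subst_vars (y_var :: 'a \<Rightarrow> _)"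
    by (rule comm_ring_hom_subst_vars)
  show ?thesis
    by (simp add: star_table_def y_eval_def subst.hom_sum subst.hom_mult)
qed

section \<open>Both Cayley tables as products with \<open>sharp_table\<close>\<close>

context smooth_semigroup
begin

text \<open>Writing the summation conditions as 0/1 coefficients exhibits an entry of a product of
  three matrices.\<close>

lemma y_eval_star_Z:
  "y_eval (star_Z s t) =
    (\<Sum>s'\<in>UNIV. of_bool (strong_ll s' s) * (\<Sum>t'\<in>UNIV. sharp_table s' t' * of_bool (t' \<lless> t)))"
  for s t :: 'a
proof -
  have inner: "(\<Sum>t' | t' \<lless> t. sharp_table s' t') = (\<Sum>t'\<in>UNIV. sharp_table s' t' * of_bool (t' \<lless> t))"
    for s'
    by (rule sum.mono_neutral_cong_left) auto
  have "y_eval (star_Z s t) = (\<Sum>s' | strong_ll s' s. \<Sum>t' | t' \<lless> t. sharp_table s' t')"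
    by (simp add: star_Z_eq y_eval_sum sharp_table_def)
  also have "\<dots> = (\<Sum>s'\<in>UNIV. of_bool (strong_ll s' s) * (\<Sum>t' | t' \<lless> t. sharp_table s' t'))"
    by (rule sum.mono_neutral_cong_left) auto
  finally show ?thesis by (simp only: inner)
qed

text \<open>By Moebius inversion \<open>var (s * t)\<close> is the value of \<open>y_eval\<close> at
  \<open>Z\<close> of \<open>s * t\<close>, and \<open>Z\<close> is multiplicative.\<close>

lemma var_mult: "var (s * t) = y_eval (star_Z s t)" for s t :: 'a
  by (simp add: sum_ll_product_eq_star_Z[symmetric] y_eval_sum y_eval_basis sum_y_var)

text \<open>The transposed inverse of zeta times the matrix of \<open>strong_ll\<close>.\<close>

definition star_coeff :: "'a \<Rightarrow> 'a \<Rightarrow> 'a spoly" where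
  "star_coeff s s' = (\<Sum>a\<in>UNIV. of_int (mu a s) * of_bool (strong_ll s' a))"

text \<open>Both arguments are expanded by \<open>mu\<close>. In the right one, \<open>mu\<close>
  cancels the full relation \<open>\<lless>\<close>; in the left one it meets only
  \<open>strong_ll\<close>, and \<open>star_coeff\<close> remains.\<close>

lemma y_eval_star_mult:
  "y_eval (star_mult (basis s) (basis t)) = (\<Sum>s'\<in>UNIV. star_coeff s s' * sharp_table s' t)"
  for s t :: 'a
proof -
  have inner: "(\<Sum>b\<in>UNIV. of_int (mu b t) * y_eval (star_Z a b)) =
      (\<Sum>s'\<in>UNIV. of_bool (strong_ll s' a) * sharp_table s' t)" for a :: 'a
  proof -
    have "(\<Sum>b\<in>UNIV. of_int (mu b t) * y_eval (star_Z a b)) =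
        (\<Sum>b\<in>UNIV. \<Sum>s'\<in>UNIV. \<Sum>t'\<in>UNIV. of_bool (strong_ll s' a) *
          (sharp_table s' t' * (of_bool (t' \<lless> b) * of_int (mu b t))))"
      by (simp only: y_eval_star_Z sum_distrib_left mult_ac)
    also have "\<dots> = (\<Sum>s'\<in>UNIV. \<Sum>b\<in>UNIV. \<Sum>t'\<in>UNIV. of_bool (strong_ll s' a) *
          (sharp_table s' t' * (of_bool (t' \<lless> b) * of_int (mu b t))))"
      by (rule sum.swap)
    also have "\<dots> = (\<Sum>s'\<in>UNIV. \<Sum>t'\<in>UNIV. \<Sum>b\<in>UNIV. of_bool (strong_ll s' a) *
          (sharp_table s' t' * (of_bool (t' \<lless> b) * of_int (mu b t))))"
      by (intro sum.cong refl sum.swap)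
    also have "\<dots> = (\<Sum>s'\<in>UNIV. of_bool (strong_ll s' a) * (\<Sum>t'\<in>UNIV. sharp_table s' t' * of_bool (t' = t)))"
      by (simp only: sum_distrib_left[symmetric] mu_inverse_of_int)
    finally show ?thesis by simp
  qed
  have "y_eval (star_mult (basis s) (basis t)) =
      (\<Sum>a\<in>UNIV. of_int (mu a s) * (\<Sum>b\<in>UNIV. of_int (mu b t) * y_eval (star_Z a b)))"
    by (simp only: star_mult_basis y_eval_sum y_eval_scale const.hom_mult of_int_spoly
        sum_distrib_left mult.assoc)
  also have "\<dots> = (\<Sum>a\<in>UNIV. \<Sum>s'\<in>UNIV. of_int (mu a s) * of_bool (strong_ll s' a) * sharp_table s' t)"
    by (simp only: inner sum_distrib_left mult.assoc)
  also have "\<dots> = (\<Sum>s'\<in>UNIV. \<Sum>a\<in>UNIV. of_int (mu a s) * of_bool (strong_ll s' a) * sharp_table s' t)"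
    by (rule sum.swap)
  finally show ?thesis by (simp only: star_coeff_def sum_distrib_right)
qed

text \<open>A nonzero term needs \<open>a \<lless> s\<close> and \<open>s \<lless> a\<close>, so
  only \<open>a = s\<close> survives.\<close>

lemma star_coeff_diag: "star_coeff s s = 1"
proof -
  have "star_coeff s s = (\<Sum>a\<in>{s}. of_int (mu a s) * of_bool (strong_ll s a))"
    unfolding star_coeff_def
    by (rule sum.mono_neutral_right) (use mu_inverse(1) ll_antisym in \<open>auto simp: strong_ll_def\<close>)
  then show ?thesis by (simp add: mu_diag strong_ll_refl)
qed

lemma star_coeff_nonzero_imp:
  assumes "star_coeff s s' \<noteq> 0" shows "s' \<lless> s"
proof -
  obtain a where "of_int (mu a s) * of_bool (strong_ll s' a) \<noteq> (0 :: 'a spoly)"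
    using assms unfolding star_coeff_def by (meson sum.neutral)
  then have "mu a s \<noteq> 0" "strong_ll s' a"
    by (metis mult_zero_left of_int_0, metis mult_zero_right of_bool_eq(1))
  then have "a \<lless> s" "s' \<lless> a" using mu_inverse(1)[of a s] by (auto simp: strong_ll_def)
  then show ?thesis using ll_trans by blast
qed

text \<open>The sizes of lower sets, respectively upper sets, serve as the rank.\<close>

lemma list_det_ll_unitriangular:
  fixes M :: "'a \<Rightarrow> 'a \<Rightarrow> 'r::comm_ring_1"
  assumes "distinct xs" "\<And>s. M s s = 1"
  shows "(\<And>s t. M s t \<noteq> 0 \<Longrightarrow> s \<lless> t) \<Longrightarrow> list_det M xs xs = 1"
    and "(\<And>s t. M s t \<noteq> 0 \<Longrightarrow> t \<lless> s) \<Longrightarrow> list_det M xs xs = 1"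
proof -
  have "card {u. u \<lless> s} < card {u. u \<lless> t}" "card {u. t \<lless> u} < card {u. s \<lless> u}"
    if "s \<lless> t" "s \<noteq> t" for s t :: 'a
  proof -
    have "{u. u \<lless> s} \<subset> {u. u \<lless> t}" "{u. t \<lless> u} \<subset> {u. s \<lless> u}"
      using that ll_refl ll_antisym ll_trans by blast+
    then show "card {u. u \<lless> s} < card {u. u \<lless> t}" "card {u. t \<lless> u} < card {u. s \<lless> u}"
      by (simp_all add: psubset_card_mono)
  qed
  note card = this
  show "list_det M xs xs = 1" if "\<And>s t. M s t \<noteq> 0 \<Longrightarrow> s \<lless> t"
    by (rule list_det_unitriangular[where r = "\<lambda>s. card {u. u \<lless> s}"]) (use assms that card in auto)
  show "list_det M xs xs = 1" if "\<And>s t. M s t \<noteq> 0 \<Longrightarrow> t \<lless> s"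
    by (rule list_det_unitriangular[where r = "\<lambda>s. card {u. s \<lless> u}"]) (use assms that card in auto)
qed

text \<open>The outer factors in \<open>y_eval_star_Z\<close> are unitriangular for
  \<open>\<lless>\<close>, in opposite directions.\<close>

lemma theta_eq_det_sharp_table:
  assumes "enumerates xs (UNIV :: 'a set)"
  shows "theta xs = list_det sharp_table xs xs"
proof -
  let ?A = "\<lambda>s s'. of_bool (strong_ll s' s) :: 'a spoly"
  let ?B = "\<lambda>s t. of_bool (s \<lless> t) :: 'a spoly"
  have xs: "distinct xs" "set xs = UNIV" using assms by (simp_all add: enumerates_def)
  have "theta xs = list_det (\<lambda>s t. \<Sum>s'\<in>set xs. ?A s s' * (\<Sum>t'\<in>set xs. sharp_table s' t' * ?B t' t)) xs xs"
    by (simp add: theta_def submatrix_det_eq_list_det var_mult y_eval_star_Z xs)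
  also have "\<dots> = list_det ?A xs xs * (list_det sharp_table xs xs * list_det ?B xs xs)"
    by (simp only: list_det_mult[OF refl xs(1)])
  also have "list_det ?A xs xs = 1"
    by (rule list_det_ll_unitriangular(2)[OF xs(1)]) (auto simp: strong_ll_refl strong_ll_def)
  also have "list_det ?B xs xs = 1"
    by (rule list_det_ll_unitriangular(1)[OF xs(1)]) (auto simp: ll_refl)
  finally show ?thesis by simp
qed

lemma subst_theta_tilde_eq_det_sharp_table:
  fixes e :: 'a
  assumes rs: "enumerates rs (Lt e)" and cs: "enumerates cs (Rt e)"
  shows "subst_vars y_var (theta_tilde rs cs) = list_det sharp_table rs cs"
proof -
  interpret subst: comm_ring_hom "subst_vars (y_var :: 'a \<Rightarrow> _)"
    by (rule comm_ring_hom_subst_vars)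
  have "subst_vars y_var (theta_tilde rs cs) =
      list_det (\<lambda>s t. \<Sum>s'\<in>UNIV. star_coeff s s' * sharp_table s' t) rs cs"
    by (simp only: theta_tilde_def submatrix_det_eq_list_det subst.hom_list_det
        subst_vars_star_table y_eval_star_mult)
  also have "\<dots> = list_det (\<lambda>s t. \<Sum>s'\<in>set rs. star_coeff s s' * sharp_table s' t) rs cs"
  proof (rule list_det_cong)
    \<comment> \<open>A column from \<open>Rt e\<close> has nonzero entries only in rows from
      \<open>Lt e\<close>, so the sum over all \<open>s'\<close> reduces to the block.\<close>
    fix s t assume "t \<in> set cs"
    then have "sharp_table s' t = 0" if "s' \<notin> set rs" for s'
      using rs cs that sharp_table_nonzero_imp[of s' t] by (auto simp: enumerates_def Lt_def Rt_def)
    then show "(\<Sum>s'\<in>UNIV. star_coeff s s' * sharp_table s' t) =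
        (\<Sum>s'\<in>set rs. star_coeff s s' * sharp_table s' t)"
      by (intro sum.mono_neutral_right) auto
  qed
  also have "\<dots> = list_det star_coeff rs rs * list_det sharp_table rs cs"
    by (rule list_det_mult) (use rs in \<open>simp_all add: enumerates_def\<close>)
  also have "list_det star_coeff rs rs = 1"
    by (rule list_det_ll_unitriangular(2))
      (use rs star_coeff_diag star_coeff_nonzero_imp in \<open>auto simp: enumerates_def\<close>)
  finally show ?thesis by simp
qed

end

theorem theorem5p11:
  fixes xs :: "'a::{finite,semigroup_mult} list"
    and rows cols :: "'a \<Rightarrow> 'a list"
  assumes unital: "salg_unital TYPE('a)"
    and smooth: "ll_smooth TYPE('a)"
    and xs: "enumerates xs (UNIV :: 'a set)"
    and rows: "\<And>e. e \<in> idempotents \<Longrightarrow> enumerates (rows e) (Lt e)"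
    and cols: "\<And>e. e \<in> idempotents \<Longrightarrow> enumerates (cols e) (Rt e)"
  shows "(theta xs = (\<Prod>e\<in>idempotents. subst_vars y_var (theta_tilde (rows e) (cols e))) \<or>
          theta xs = - (\<Prod>e\<in>idempotents. subst_vars y_var (theta_tilde (rows e) (cols e)))) \<and>
         (theta xs \<noteq> 0 \<longleftrightarrow>
            (\<forall>e\<in>idempotents. subst_vars y_var (theta_tilde (rows e) (cols e)) \<noteq> 0))"
proof -
  interpret smooth_semigroup "TYPE('a)"
    using smooth unital by unfold_locales
  let ?N = "sharp_table :: 'a \<Rightarrow> 'a \<Rightarrow> 'a spoly"
  have blocks: "subst_vars y_var (theta_tilde (rows e) (cols e)) = list_det ?N (rows e) (cols e)"
    if "e \<in> idempotents" for e
    using subst_theta_tilde_eq_det_sharp_table[OF rows[OF that] cols[OF that]] .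
  define P where "P = (\<Prod>e\<in>idempotents. subst_vars y_var (theta_tilde (rows e) (cols e)))"
  have P: "P = (\<Prod>e\<in>idempotents. list_det ?N (rows e) (cols e))"
    unfolding P_def by (rule prod.cong) (simp_all add: blocks)
  \<comment> \<open>The block determinant formula is available over integral domains, so the entries
    are moved to \<open>nat spoly\<close>; injectivity of \<open>h\<close> brings the result
    back.\<close>
  obtain h :: "'a spoly \<Rightarrow> nat spoly" where "comm_ring_hom h" and inj: "inj h"
    using ex_embedding_into_numbered_variables by blast
  interpret h: comm_ring_hom h by fact
  have "list_det (\<lambda>s t. h (?N s t)) xs xs = (\<Prod>e\<in>idempotents. list_det (\<lambda>s t. h (?N s t)) (rows e) (cols e)) \<or>
      list_det (\<lambda>s t. h (?N s t)) xs xs = - (\<Prod>e\<in>idempotents. list_det (\<lambda>s t. h (?N s t)) (rows e) (cols e))"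
  proof (rule list_det_block_diagonal[where f = sstar and g = splus])
    show "sstar s = splus t" if "h (?N s t) \<noteq> 0" for s t
      using that by (metis h.hom_zero sharp_table_nonzero_imp)
  qed (use xs rows cols in \<open>auto simp: enumerates_def Lt_def Rt_def idempotents_def\<close>)
  then have "h (theta xs) = h P \<or> h (theta xs) = h (- P)"
    unfolding theta_eq_det_sharp_table[OF xs] P
    by (simp only: h.hom_list_det h.hom_prod h.hom_uminus)
  then have sign: "theta xs = P \<or> theta xs = - P"
    using inj by (simp add: inj_eq)
  have nonzero: "h p \<noteq> 0 \<longleftrightarrow> p \<noteq> 0" for p
    using inj_eq[OF inj, of p 0] by simp
  \<comment> \<open>In the domain \<open>nat spoly\<close> the image of the product is nonzero
    exactly when every factor is.\<close>
  have "P \<noteq> 0 \<longleftrightarrow> h P \<noteq> 0" by (simp add: nonzero)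
  also have "\<dots> \<longleftrightarrow> (\<forall>e\<in>idempotents. subst_vars y_var (theta_tilde (rows e) (cols e)) \<noteq> 0)"
    by (simp add: P_def h.hom_prod nonzero)
  finally show ?thesis
    using sign unfolding P_def by auto
qed

end
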